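(* Let $G=C_{n,n}$ be the crown graph with $n\ge 3$, and let $J_G$ be its binomial edge ideal. Then the height of $J_G$ is $2n-1$ and the big height of $J_G$ is $4n-6$.
   Context: The crown graph $C_{n,n}$ is the bipartite graph with vertex set $\{1,\ldots,2n\}$, parts $X=\{2i-1 : 1\le i\le n\}$ and $Y=\{2i : 1\le i\le n\}$, and edges $\{2i-1,2j\}$ for all $i,j\in\{1,\ldots,n\}$ with $i\ne j$. For a finite simple graph $G$ on vertex set $\{1,\ldots,m\}$ and an arbitrary field $\mathbb{K}$, let $S=\mathbb{K}[x_1,\ldots,x_m,y_1,\ldots,y_m]$ (standard graded); the binomial edge ideal is $J_G=\langle x_iy_j-x_jy_i : \{i,j\}\in E(G)\rangle\subseteq S$. The big height of an ideal is the largest height of its minimal primes. (For $C_{n,n}$, $m=2n$.) *)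

theory Defs
  imports
    "HOL-Algebra.Ideal"
    "HOL-Library.Poly_Mapping"
    "HOL-Library.Extended_Nat"
begin

section \<open>Polynomial rings in a set of variables\<close>

text \<open>A polynomial is a finitely supported map from monomials to coefficients, and a monomial is a
  finitely supported map from variables to exponents. The ring \<open>poly_ring V\<close> consists of
  the polynomials whose monomials only involve variables from \<open>V\<close>; ideals and prime
  ideals are those of this ring, not of the ring of polynomials in all variables of the type.\<close>

type_synonym ('v, 'k) mpoly = "('v \<Rightarrow>\<^sub>0 nat) \<Rightarrow>\<^sub>0 'k"

definition poly_ring :: "'v set \<Rightarrow> ('v, 'k::field) mpoly ring" where
  "poly_ring V =
    \<lparr>carrier = {p. \<forall>m \<in> Poly_Mapping.keys p. Poly_Mapping.keys m \<subseteq> V},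
     mult = (*), one = 1, zero = 0, add = (+)\<rparr>"

definition pvar :: "'v \<Rightarrow> ('v, 'k::field) mpoly" where
  "pvar v = Poly_Mapping.single (Poly_Mapping.single v 1) 1"

lemma poly_ring_cring: "cring (poly_ring V :: ('v, 'k::field) mpoly ring)"
proof -
  let ?R = "poly_ring V :: ('v, 'k) mpoly ring"
  have add: "p \<oplus>\<^bsub>?R\<^esub> q = p + q" and mult: "p \<otimes>\<^bsub>?R\<^esub> q = p * q" for p q
    by (simp_all add: poly_ring_def)
  have plus: "p + q \<in> carrier ?R" if "p \<in> carrier ?R" "q \<in> carrier ?R" for p q
    using that Poly_Mapping.keys_add[of p q] unfolding poly_ring_def partial_object.simps mem_Collect_eq by blast
  have times: "p * q \<in> carrier ?R" if pq: "p \<in> carrier ?R" "q \<in> carrier ?R" for p q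
  proof -
    have "Poly_Mapping.keys m \<subseteq> V" if m: "m \<in> Poly_Mapping.keys (p * q)" for m
    proof -
      obtain a b where ab: "m = a + b" "a \<in> Poly_Mapping.keys p" "b \<in> Poly_Mapping.keys q"
        using m Poly_Mapping.keys_mult[of p q] by blast
      then show ?thesis
        using pq Poly_Mapping.keys_add[of a b] unfolding poly_ring_def partial_object.simps mem_Collect_eq by blast
    qed
    then show ?thesis by (simp add: poly_ring_def)
  qed
  show ?thesis
  proof (intro cringI abelian_groupI comm_monoidI)
    fix x y z assume xyz: "x \<in> carrier ?R" "y \<in> carrier ?R" "z \<in> carrier ?R"
    show "x \<oplus>\<^bsub>?R\<^esub> y \<in> carrier ?R" using plus xyz by (simp add: add)
    show "x \<otimes>\<^bsub>?R\<^esub> y \<in> carrier ?R" using times xyz by (simp add: mult)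
    show "x \<oplus>\<^bsub>?R\<^esub> y \<oplus>\<^bsub>?R\<^esub> z = x \<oplus>\<^bsub>?R\<^esub> (y \<oplus>\<^bsub>?R\<^esub> z)" by (simp only: add add.assoc)
    show "x \<oplus>\<^bsub>?R\<^esub> y = y \<oplus>\<^bsub>?R\<^esub> x" by (simp only: add add.commute)
    show "x \<otimes>\<^bsub>?R\<^esub> y \<otimes>\<^bsub>?R\<^esub> z = x \<otimes>\<^bsub>?R\<^esub> (y \<otimes>\<^bsub>?R\<^esub> z)" by (simp only: mult mult.assoc)
    show "x \<otimes>\<^bsub>?R\<^esub> y = y \<otimes>\<^bsub>?R\<^esub> x" by (simp only: mult mult.commute)
    show "(x \<oplus>\<^bsub>?R\<^esub> y) \<otimes>\<^bsub>?R\<^esub> z = x \<otimes>\<^bsub>?R\<^esub> z \<oplus>\<^bsub>?R\<^esub> y \<otimes>\<^bsub>?R\<^esub> z"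
      by (simp only: add mult distrib_right)
    have "- x \<in> carrier ?R" using xyz(1) by (simp add: poly_ring_def in_keys_iff)
    then show "\<exists>y \<in> carrier ?R. y \<oplus>\<^bsub>?R\<^esub> x = \<zero>\<^bsub>?R\<^esub>"
      by (rule bexI[rotated]) (simp add: poly_ring_def)
  qed (simp_all add: poly_ring_def)
qed

section \<open>Height and big height\<close>

text \<open>Heights are extended naturals; a chain with \<open>k\<close> strict inclusions has length \<open>k\<close>.\<close>

definition prime_height :: "('a, 'm) ring_scheme \<Rightarrow> 'a set \<Rightarrow> enat" where
  "prime_height R P =
    Sup {enat k | k. \<exists>Q :: nat \<Rightarrow> 'a set.
           (\<forall>i \<le> k. primeideal (Q i) R) \<and> (\<forall>i < k. Q i \<subset> Q (Suc i)) \<and> Q k = P}"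

definition minimal_primes :: "('a, 'm) ring_scheme \<Rightarrow> 'a set \<Rightarrow> 'a set set" where
  "minimal_primes R I =
    {P. primeideal P R \<and> I \<subseteq> P \<and> (\<forall>Q. primeideal Q R \<and> I \<subseteq> Q \<and> Q \<subseteq> P \<longrightarrow> Q = P)}"

definition ideal_height :: "('a, 'm) ring_scheme \<Rightarrow> 'a set \<Rightarrow> enat" where
  "ideal_height R I = (INF P \<in> {P. primeideal P R \<and> I \<subseteq> P}. prime_height R P)"

text \<open>A finite supremum of extended naturals over a nonempty set is attained, so a finite
  value of \<open>big_height\<close> is the largest height of a minimal prime.\<close>

definition big_height :: "('a, 'm) ring_scheme \<Rightarrow> 'a set \<Rightarrow> enat" where
  "big_height R I = (SUP P \<in> minimal_primes R I. prime_height R P)"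

section \<open>Binomial edge ideals\<close>

datatype edge_var = XVar nat | YVar nat

text \<open>A graph is given by its vertex set and its set of edges, each edge being a two-element set
  of vertices.\<close>

definition simple_graph :: "nat set \<Rightarrow> nat set set \<Rightarrow> bool" where
  "simple_graph V E \<longleftrightarrow> finite V \<and> (\<forall>e \<in> E. e \<subseteq> V \<and> card e = 2)"

definition edge_ring :: "nat set \<Rightarrow> (edge_var, 'k::field) mpoly ring" where
  "edge_ring V = poly_ring (XVar ` V \<union> YVar ` V)"

definition binomial_edge_ideal :: "nat set \<Rightarrow> nat set set \<Rightarrow> (edge_var, 'k::field) mpoly set" where
  "binomial_edge_ideal V E =
    Idl\<^bsub>edge_ring V\<^esub>
      {pvar (XVar i) * pvar (YVar j) - pvar (XVar j) * pvar (YVar i) | i j. {i, j} \<in> E}"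

section \<open>Crown graphs\<close>

definition crown_vertices :: "nat \<Rightarrow> nat set" where
  "crown_vertices n = {1..2 * n}"

definition crown_edges :: "nat \<Rightarrow> nat set set" where
  "crown_edges n = {{2 * i - 1, 2 * j} | i j. i \<in> {1..n} \<and> j \<in> {1..n} \<and> i \<noteq> j}"

lemma simple_graph_crown: "simple_graph (crown_vertices n) (crown_edges n)"
proof -
  have "e \<subseteq> {1..2 * n} \<and> card e = 2" if e_in: "e \<in> crown_edges n" for e
  proof -
    obtain i j where e: "e = {2 * i - 1, 2 * j}" and ij: "i \<in> {1..n}" "j \<in> {1..n}"
      using e_in unfolding crown_edges_def by blast
    have "2 * i - 1 \<noteq> 2 * j" using ij by simp presburger
    then show ?thesis using e ij by auto
  qed
  then show ?thesis by (simp add: simple_graph_def crown_vertices_def)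
qed

end

theory Submission
  imports Defs "HOL-Library.Product_Lexorder"
begin

text \<open>
  For a set \<open>U\<close> of vertices and a labelling \<open>r\<close> of \<open>U\<close>, let \<open>Q(U, r)\<close> be the kernel of the
  substitution that kills the variables of the vertices outside \<open>U\<close> and, for \<open>i\<close> in \<open>U\<close> with
  label \<open>c\<close>, sends \<open>x\<^sub>i\<close> and \<open>y\<^sub>i\<close> to \<open>s\<^sub>i a\<^sub>c\<close> and \<open>s\<^sub>i b\<^sub>c\<close>: on its zero set the columns
  \<open>(x\<^sub>i, y\<^sub>i)\<close> with the same label are proportional. It is prime as the kernel of a map into a
  domain. When the labels are the connected components of the subgraph induced on \<open>U\<close>, these are
  the well-known candidates for the minimal primes of a binomial edge ideal \<open>J\<close>.

  Every prime \<open>P\<close> above \<open>J\<close> contains such a candidate: let \<open>U\<close> be the set of vertices whose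
  two variables are not both in \<open>P\<close>. Modulo \<open>P\<close> the column of a vertex of \<open>U\<close> is nonzero, so
  proportionality of columns spreads along the edges inside \<open>U\<close> to whole components
  (\<open>minor_trans\<close>), and then \<open>Q(U, components) \<subseteq> P\<close> (\<open>component_prime_subset\<close>).

  With \<open>m\<close> vertices and \<open>c\<close> labels, \<open>Q(U, r)\<close> has height \<open>2m - |U| - c\<close>. A chain of that length
  is explicit: kill variables one by one, then merge labels one by one. No chain is longer:
  the \<open>x\<^sub>i\<close> with \<open>i\<close> in \<open>U\<close>, together with one \<open>y\<close> per label, are \<open>|U| + c\<close> variables in which
  \<open>Q(U, r)\<close> contains no nonzero polynomial, and going down to a strictly smaller prime always makes
  room for one more such variable (\<open>independent_mod_exchange\<close>). The latter is the fact that the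
  transcendence degree of the residue ring drops along strict inclusions of primes; it rests
  on the finiteness of algebraic extensions, with denominators cleared.

  For the crown graph \<open>m = 2n\<close>. It has a Hamiltonian path, and deleting \<open>t\<close> vertices from a path
  leaves at most \<open>t + 1\<close> pieces. Hence \<open>c \<le> 2n - |U| + 1\<close>, every prime above \<open>J\<close> has height at
  least \<open>2n - 1\<close>, and \<open>U\<close> consisting of all vertices attains this bound. If \<open>Q(U, components)\<close> is a
  minimal prime, every deleted vertex has neighbours in two different components, for otherwise
  it could be restored. As a vertex of the crown has \<open>n + 1 \<ge> 4\<close> non-neighbours (itself included),
  this forces \<open>|U| + c \<ge> 6\<close>, hence height at most \<open>4n - 6\<close>. Equality is attained when the two
  disjoint edges on the vertices \<open>1, 2, 3, 4\<close> are all that is left.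
\<close>

section \<open>Polynomials and induction on them\<close>

text \<open>A linear order on the variables orders the monomials lexicographically, which makes the
  polynomials an integral domain: leading terms multiply.\<close>

instantiation edge_var :: linorder
begin

fun edge_var_rank :: "edge_var \<Rightarrow> nat" where
  "edge_var_rank (XVar i) = 2 * i"
| "edge_var_rank (YVar i) = 2 * i + 1"

definition less_eq_edge_var :: "edge_var \<Rightarrow> edge_var \<Rightarrow> bool" where
  "v \<le> w \<longleftrightarrow> edge_var_rank v \<le> edge_var_rank w"

definition less_edge_var :: "edge_var \<Rightarrow> edge_var \<Rightarrow> bool" where
  "v < w \<longleftrightarrow> edge_var_rank v < edge_var_rank w"

instance
proof
  fix v w :: edge_var
  assume "v \<le> w" "w \<le> v"
  then have "edge_var_rank v = edge_var_rank w" by (simp add: less_eq_edge_var_def)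
  then show "v = w" by (cases v; cases w) (simp; presburger)+
qed (auto simp: less_eq_edge_var_def less_edge_var_def)

end

abbreviation polys :: "'v set \<Rightarrow> ('v, 'k::field) mpoly set" where
  "polys V \<equiv> carrier (poly_ring V)"

abbreviation const :: "'k \<Rightarrow> ('v, 'k::field) mpoly" where
  "const a \<equiv> Poly_Mapping.single 0 a"

lemma polys_iff: "p \<in> polys V \<longleftrightarrow> (\<forall>m \<in> Poly_Mapping.keys p. Poly_Mapping.keys m \<subseteq> V)"
  by (simp add: poly_ring_def)

lemma poly_ring_ops [simp]:
  "p \<oplus>\<^bsub>poly_ring V\<^esub> q = p + q" "p \<otimes>\<^bsub>poly_ring V\<^esub> q = p * q"
  "\<one>\<^bsub>poly_ring V\<^esub> = 1" "\<zero>\<^bsub>poly_ring V\<^esub> = 0"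
  by (simp_all add: poly_ring_def)

lemma polys_add: "p \<in> polys V \<Longrightarrow> q \<in> polys V \<Longrightarrow> p + q \<in> polys V"
  using cring.cring_simprules(1)[OF poly_ring_cring, of p V q] by simp

lemma polys_mult: "p \<in> polys V \<Longrightarrow> q \<in> polys V \<Longrightarrow> p * q \<in> polys V"
  using cring.cring_simprules(5)[OF poly_ring_cring, of p V q] by simp

lemma polys_const: "const a \<in> polys V"
  by (auto simp: polys_iff)

lemma polys_0: "0 \<in> polys V" and polys_1: "1 \<in> polys V"
  by (auto simp: polys_iff)

lemma polys_uminus: "p \<in> polys V \<Longrightarrow> - p \<in> polys V"
  by (simp add: polys_iff in_keys_iff)

lemma polys_diff: "p \<in> polys V \<Longrightarrow> q \<in> polys V \<Longrightarrow> p - q \<in> polys V"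
  using polys_add[of p V "- q"] polys_uminus[of q V] by simp

lemma polys_pvar: "v \<in> V \<Longrightarrow> pvar v \<in> polys V"
  by (auto simp: polys_iff pvar_def)

lemma polys_power: "p \<in> polys V \<Longrightarrow> p ^ k \<in> polys V"
  by (induction k) (auto intro: polys_1 polys_mult)

lemma polys_sum: "(\<And>i. i \<in> I \<Longrightarrow> f i \<in> polys V) \<Longrightarrow> sum f I \<in> polys V"
  by (induction I rule: infinite_finite_induct) (auto intro: polys_0 polys_add)

lemma polys_mono: "U \<subseteq> V \<Longrightarrow> polys U \<subseteq> polys V"
  unfolding polys_iff subset_iff by blast

lemmas polys_closed = polys_add polys_mult polys_const polys_0 polys_1 polys_uminus polys_diff
  polys_pvar polys_power polys_sum

lemma pvar_mult_single:
  "pvar v * Poly_Mapping.single m a = Poly_Mapping.single (Poly_Mapping.single v 1 + m) a"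
  by (simp add: pvar_def mult_single)

lemma sum_singles: "p = (\<Sum>m\<in>Poly_Mapping.keys p. Poly_Mapping.single m (Poly_Mapping.lookup p m))"
proof (rule poly_mapping_eqI)
  fix k
  show "Poly_Mapping.lookup p k = Poly_Mapping.lookup (\<Sum>m\<in>Poly_Mapping.keys p. Poly_Mapping.single m (Poly_Mapping.lookup p m)) k"
    by (cases "k \<in> Poly_Mapping.keys p")
       (auto simp: lookup_sum lookup_single when_def in_keys_iff)
qed

text \<open>A monomial is built from a constant by multiplying with one variable at a time. So for a
  property that is closed under addition, the step to products with a single variable suffices.\<close>

lemma polys_induct [consumes 1, case_names const add var]:
  assumes p: "p \<in> polys V"
    and const: "\<And>a. A (const a)"
    and add: "\<And>p q. p \<in> polys V \<Longrightarrow> q \<in> polys V \<Longrightarrow> A p \<Longrightarrow> A q \<Longrightarrow> A (p + q)"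
    and var: "\<And>v p. v \<in> V \<Longrightarrow> p \<in> polys V \<Longrightarrow> A p \<Longrightarrow> A (pvar v * p)"
  shows "A p"
proof -
  have mon: "A (Poly_Mapping.single m a)"
    if "Poly_Mapping.keys m \<subseteq> V" "(\<Sum>v\<in>Poly_Mapping.keys m. Poly_Mapping.lookup m v) = d" for m a d
    using that
  proof (induction d arbitrary: m)
    case 0
    then have "m = 0" by (intro poly_mapping_eqI) (auto simp: in_keys_iff)
    then show ?case using const by simp
  next
    case (Suc d)
    then obtain v where v: "v \<in> Poly_Mapping.keys m"
      by (metis Zero_neq_Suc all_not_in_conv sum.empty)
    define m' where "m' = m - Poly_Mapping.single v 1"
    have m: "m = Poly_Mapping.single v 1 + m'"
      using v by (intro poly_mapping_eqI)
        (auto simp: m'_def lookup_add lookup_minus lookup_single when_def in_keys_iff)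
    have sub: "Poly_Mapping.keys m' \<subseteq> Poly_Mapping.keys m"
      by (auto simp: m in_keys_iff lookup_add)
    have "(\<Sum>w\<in>Poly_Mapping.keys m'. Poly_Mapping.lookup m' w) = (\<Sum>w\<in>Poly_Mapping.keys m. Poly_Mapping.lookup m' w)"
      using sub by (intro sum.mono_neutral_left) (auto simp: in_keys_iff)
    moreover have "(\<Sum>w\<in>Poly_Mapping.keys m. Poly_Mapping.lookup m w) = 1 + (\<Sum>w\<in>Poly_Mapping.keys m. Poly_Mapping.lookup m' w)"
    proof -
      have "Poly_Mapping.lookup m w = (if w = v then 1 else 0) + Poly_Mapping.lookup m' w" for w
        by (simp add: m lookup_add lookup_single when_def)
      then have "(\<Sum>w\<in>Poly_Mapping.keys m. Poly_Mapping.lookup m w)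
          = (\<Sum>w\<in>Poly_Mapping.keys m. (if w = v then 1 else 0) + Poly_Mapping.lookup m' w)"
        by (intro sum.cong refl)
      then show ?thesis using v by (simp add: sum.distrib)
    qed
    ultimately have "(\<Sum>w\<in>Poly_Mapping.keys m'. Poly_Mapping.lookup m' w) = d" using Suc.prems by simp
    then have "A (Poly_Mapping.single m' a)" using Suc sub by blast
    moreover have "Poly_Mapping.single m' a \<in> polys V" using Suc.prems sub by (auto simp: polys_iff)
    ultimately have "A (pvar v * Poly_Mapping.single m' a)" using var v Suc.prems by blast
    then show ?case by (simp only: pvar_mult_single m[symmetric])
  qed
  have "A (\<Sum>m\<in>I. Poly_Mapping.single m (Poly_Mapping.lookup p m)) \<and> (\<Sum>m\<in>I. Poly_Mapping.single m (Poly_Mapping.lookup p m)) \<in> polys V"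
    if "finite I" "I \<subseteq> Poly_Mapping.keys p" for I
    using that
  proof (induction I rule: finite_induct)
    case empty
    then show ?case using const[of 0] by (simp add: polys_0)
  next
    case (insert m I)
    then have m: "Poly_Mapping.keys m \<subseteq> V" using p by (auto simp: polys_iff)
    then have "Poly_Mapping.single m (Poly_Mapping.lookup p m) \<in> polys V" by (auto simp: polys_iff)
    with insert m mon show ?case by (auto intro!: add polys_add)
  qed
  from this[of "Poly_Mapping.keys p"] show ?thesis using sum_singles[of p] by simp
qed

lemma polys_UNIV: "p \<in> polys UNIV"
  by (simp add: polys_iff)

section \<open>Substitution\<close>

definition monom_subst :: "('v \<Rightarrow> ('w, 'k::field) mpoly) \<Rightarrow> ('v \<Rightarrow>\<^sub>0 nat) \<Rightarrow> ('w, 'k) mpoly" where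
  "monom_subst \<sigma> m = (\<Prod>v\<in>Poly_Mapping.keys m. \<sigma> v ^ Poly_Mapping.lookup m v)"

definition poly_subst :: "('v \<Rightarrow> ('w, 'k::field) mpoly) \<Rightarrow> ('v, 'k) mpoly \<Rightarrow> ('w, 'k) mpoly" where
  "poly_subst \<sigma> p = (\<Sum>m\<in>Poly_Mapping.keys p. const (Poly_Mapping.lookup p m) * monom_subst \<sigma> m)"

lemma monom_subst_superset:
  "finite K \<Longrightarrow> Poly_Mapping.keys m \<subseteq> K \<Longrightarrow> monom_subst \<sigma> m = (\<Prod>v\<in>K. \<sigma> v ^ Poly_Mapping.lookup m v)"
  unfolding monom_subst_def by (intro prod.mono_neutral_left) (auto simp: in_keys_iff)

lemma poly_subst_superset:
  "finite K \<Longrightarrow> Poly_Mapping.keys p \<subseteq> K \<Longrightarrow>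
    poly_subst \<sigma> p = (\<Sum>m\<in>K. const (Poly_Mapping.lookup p m) * monom_subst \<sigma> m)"
  unfolding poly_subst_def by (intro sum.mono_neutral_left) (auto simp: in_keys_iff)

lemma monom_subst_add: "monom_subst \<sigma> (m + m') = monom_subst \<sigma> m * monom_subst \<sigma> m'"
proof -
  let ?K = "Poly_Mapping.keys m \<union> Poly_Mapping.keys m'"
  have "monom_subst \<sigma> (m + m') = (\<Prod>v\<in>?K. \<sigma> v ^ Poly_Mapping.lookup (m + m') v)"
    by (intro monom_subst_superset) (auto simp: keys_add)
  also have "\<dots> = monom_subst \<sigma> m * monom_subst \<sigma> m'"
    by (subst (1 2) monom_subst_superset[of ?K]) (auto simp: lookup_add power_add prod.distrib)
  finally show ?thesis .
qed

lemma poly_subst_add: "poly_subst \<sigma> (p + q) = poly_subst \<sigma> p + poly_subst \<sigma> q"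
proof -
  let ?K = "Poly_Mapping.keys p \<union> Poly_Mapping.keys q"
  have "poly_subst \<sigma> (p + q) = (\<Sum>m\<in>?K. const (Poly_Mapping.lookup (p + q) m) * monom_subst \<sigma> m)"
    by (intro poly_subst_superset) (auto simp: keys_add)
  also have "\<dots> = poly_subst \<sigma> p + poly_subst \<sigma> q"
    by (subst (1 2) poly_subst_superset[of ?K])
       (auto simp: lookup_add single_add ring_distribs sum.distrib)
  finally show ?thesis .
qed

lemma poly_subst_const [simp]: "poly_subst \<sigma> (const a) = const a"
  by (cases "a = 0") (auto simp: poly_subst_def monom_subst_def)

lemma poly_subst_0 [simp]: "poly_subst \<sigma> 0 = 0"
  by (simp add: poly_subst_def)

lemma poly_subst_pvar_mult:
  fixes \<sigma> :: "'v \<Rightarrow> ('w, 'k::field) mpoly"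
  shows "poly_subst \<sigma> (pvar v * p) = \<sigma> v * poly_subst \<sigma> p"
proof -
  have inj: "inj_on ((+) (Poly_Mapping.single v (1::nat))) A" for A
    by (auto simp: inj_on_def)
  have 1: "pvar v * p = (\<Sum>m\<in>Poly_Mapping.keys p. Poly_Mapping.single (Poly_Mapping.single v 1 + m) (Poly_Mapping.lookup p m))"
    by (subst (1) sum_singles[of p]) (simp add: sum_distrib_left pvar_mult_single)
  have lk: "Poly_Mapping.lookup (pvar v * p) (Poly_Mapping.single v 1 + m) = Poly_Mapping.lookup p m" for m
    unfolding 1 by (auto simp: lookup_sum lookup_single when_def in_keys_iff)
  have sub: "Poly_Mapping.keys (pvar v * p) \<subseteq> (+) (Poly_Mapping.single v 1) ` Poly_Mapping.keys p"
    using keys_mult[of "pvar v" p] by (auto simp: pvar_def)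
  have "monom_subst \<sigma> (Poly_Mapping.single v 1) = \<sigma> v"
    by (simp add: monom_subst_def)
  then have "poly_subst \<sigma> (pvar v * p) = (\<Sum>m\<in>Poly_Mapping.keys p.
      const (Poly_Mapping.lookup p m) * (\<sigma> v * monom_subst \<sigma> m))"
    by (subst poly_subst_superset[OF _ sub], simp,
        subst sum.reindex[OF inj], simp only: o_def lk monom_subst_add)
  then show ?thesis by (simp only: poly_subst_def sum_distrib_left mult_ac)
qed

lemma const_mult: "const (a * b) = const a * const b"
  by (simp add: mult_single)

lemma poly_subst_const_mult: "poly_subst \<sigma> (const a * p) = const a * poly_subst \<sigma> p"
  using polys_UNIV[of p]
proof (induction rule: polys_induct)
  case (var v p)
  have *: "poly_subst \<sigma> (const a * (pvar v * p)) = poly_subst \<sigma> (pvar v * (const a * p))"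
    by (simp only: mult_ac)
  show ?case unfolding * poly_subst_pvar_mult var.IH by (simp only: mult_ac)
qed (simp_all add: const_mult[symmetric] ring_distribs poly_subst_add)

lemma poly_subst_mult: "poly_subst \<sigma> (p * q) = poly_subst \<sigma> p * poly_subst \<sigma> q"
  using polys_UNIV[of p]
proof (induction rule: polys_induct)
  case (var v p)
  then show ?case by (simp only: poly_subst_pvar_mult mult.assoc)
qed (simp_all add: poly_subst_const_mult poly_subst_add ring_distribs)

lemma poly_subst_1 [simp]: "poly_subst \<sigma> 1 = 1"
  using poly_subst_const[of \<sigma> 1] by (simp only: single_one)

lemma poly_subst_pvar [simp]: "poly_subst \<sigma> (pvar v) = \<sigma> v"
  using poly_subst_pvar_mult[of \<sigma> v 1] by simp

lemma poly_subst_diff: "poly_subst \<sigma> (p - q) = poly_subst \<sigma> p - poly_subst \<sigma> q"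
  using poly_subst_add[of \<sigma> "p - q" q] by simp

lemma poly_subst_comp:
  assumes "p \<in> polys V" and "\<And>v. v \<in> V \<Longrightarrow> poly_subst \<tau> (\<sigma> v) = \<rho> v"
  shows "poly_subst \<tau> (poly_subst \<sigma> p) = poly_subst \<rho> p"
  using assms(1)
  by (induction rule: polys_induct) (simp_all add: poly_subst_add poly_subst_mult assms(2))

section \<open>Prime ideals\<close>

lemma ideal_polysI:
  assumes "P \<subseteq> polys V" "0 \<in> P" "\<And>a b. a \<in> P \<Longrightarrow> b \<in> P \<Longrightarrow> a + b \<in> P"
    "\<And>a b. a \<in> polys V \<Longrightarrow> b \<in> P \<Longrightarrow> a * b \<in> P"
  shows "ideal P (poly_ring V :: ('v, 'k::field) mpoly ring)"
proof -
  interpret cring "poly_ring V :: ('v, 'k) mpoly ring" by (rule poly_ring_cring)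
  show ?thesis
  proof (rule idealI)
    show "subgroup P (add_monoid (poly_ring V))"
    proof (rule add.subgroupI)
      fix a assume a: "a \<in> P"
      have "(- 1) * a \<in> P" using a assms(4) by (blast intro: polys_closed)
      then have "- a \<in> P" by simp
      moreover have "\<ominus>\<^bsub>poly_ring V\<^esub> a = - a"
        using a assms(1) by (intro minus_equality) (auto intro: polys_closed)
      ultimately show "\<ominus>\<^bsub>poly_ring V\<^esub> a \<in> P" by simp
    qed (use assms in auto)
    show "a \<otimes>\<^bsub>poly_ring V\<^esub> x \<in> P" if "a \<in> P" "x \<in> polys V" for a x
      using assms(4)[OF that(2,1)] by (simp add: mult.commute)
  qed (use assms in \<open>auto intro: ring_axioms\<close>)
qed

lemma ideal_polysD:
  assumes "ideal P (poly_ring V :: ('v, 'k::field) mpoly ring)"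
  shows "P \<subseteq> polys V" "0 \<in> P" "\<And>a b. a \<in> P \<Longrightarrow> b \<in> P \<Longrightarrow> a + b \<in> P"
    "\<And>a b. a \<in> polys V \<Longrightarrow> b \<in> P \<Longrightarrow> a * b \<in> P"
    "\<And>a b. a \<in> P \<Longrightarrow> b \<in> P \<Longrightarrow> a - b \<in> P"
proof -
  interpret ideal P "poly_ring V :: ('v, 'k) mpoly ring" by fact
  show "P \<subseteq> polys V" by (rule a_subset)
  show "0 \<in> P" using additive_subgroup.zero_closed[OF is_additive_subgroup] by simp
  show add: "a + b \<in> P" if "a \<in> P" "b \<in> P" for a b using additive_subgroup.a_closed[OF is_additive_subgroup that] by simp
  show mult: "a * b \<in> P" if "a \<in> polys V" "b \<in> P" for a b using I_l_closed[OF that(2,1)] by simp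
  show "a - b \<in> P" if "a \<in> P" "b \<in> P" for a b
    using add[OF that(1) mult[of "-1" b]] that(2) by (simp add: polys_closed)
qed

lemma primeideal_polysD:
  assumes "primeideal P (poly_ring V :: ('v, 'k::field) mpoly ring)"
  shows "ideal P (poly_ring V)" "1 \<notin> P"
    "\<And>a b. a \<in> polys V \<Longrightarrow> b \<in> polys V \<Longrightarrow> a * b \<in> P \<Longrightarrow> a \<in> P \<or> b \<in> P"
proof -
  interpret primeideal P "poly_ring V :: ('v, 'k) mpoly ring" by fact
  show "ideal P (poly_ring V)" by (rule is_ideal)
  show "1 \<notin> P" using one_imp_carrier I_notcarr by auto
  show "a \<in> P \<or> b \<in> P" if "a \<in> polys V" "b \<in> polys V" "a * b \<in> P" for a b
    using I_prime[of a b] that by simp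
qed

definition subst_kernel :: "'v set \<Rightarrow> ('v \<Rightarrow> ('w, 'k::field) mpoly) \<Rightarrow> ('v, 'k) mpoly set" where
  "subst_kernel V \<sigma> = {p \<in> polys V. poly_subst \<sigma> p = 0}"

lemma primeideal_subst_kernel:
  fixes \<sigma> :: "'v \<Rightarrow> ('w::linorder, 'k::field) mpoly"
  shows "primeideal (subst_kernel V \<sigma>) (poly_ring V)"
proof (rule primeidealI)
  show "ideal (subst_kernel V \<sigma>) (poly_ring V)"
    by (rule ideal_polysI)
       (auto simp: subst_kernel_def polys_closed poly_subst_add poly_subst_mult)
  show "cring (poly_ring V :: ('v, 'k) mpoly ring)" by (rule poly_ring_cring)
  have "1 \<notin> subst_kernel V \<sigma>" "1 \<in> polys V" by (auto simp: subst_kernel_def polys_closed)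
  then show "polys V \<noteq> subst_kernel V \<sigma>" by blast
qed (auto simp: subst_kernel_def poly_subst_mult)

section \<open>Algebraic elements modulo an ideal\<close>

text \<open>When \<open>P\<close> is a prime of \<open>S\<close> that meets \<open>R\<close> in zero only, this is the field extension
  \<open>Frac R \<subseteq> Frac (S/P)\<close>, expressed through representatives with denominators cleared.\<close>

locale subring_and_ideal =
  fixes S R P :: "'a::idom set"
  assumes R_sub: "R \<subseteq> S"
    and R_zero: "0 \<in> R" and R_one: "1 \<in> R"
    and R_add: "\<And>a b. a \<in> R \<Longrightarrow> b \<in> R \<Longrightarrow> a + b \<in> R"
    and R_uminus: "\<And>a. a \<in> R \<Longrightarrow> - a \<in> R"
    and R_mult: "\<And>a b. a \<in> R \<Longrightarrow> b \<in> R \<Longrightarrow> a * b \<in> R"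
    and S_mult: "\<And>a b. a \<in> S \<Longrightarrow> b \<in> S \<Longrightarrow> a * b \<in> S"
    and P_zero: "0 \<in> P"
    and P_add: "\<And>a b. a \<in> P \<Longrightarrow> b \<in> P \<Longrightarrow> a + b \<in> P"
    and P_mult: "\<And>a b. a \<in> S \<Longrightarrow> b \<in> P \<Longrightarrow> a * b \<in> P"
begin

text \<open>The elements whose classes modulo \<open>P\<close> lie in the vector space that \<open>G\<close> spans over the
  fractions of \<open>R\<close>, with the denominator \<open>c\<close> cleared.\<close>

definition frac_span :: "'a set \<Rightarrow> 'a set" where
  "frac_span G = {h. \<exists>c r. c \<in> R \<and> c \<noteq> 0 \<and> r ` G \<subseteq> R \<and> c * h - (\<Sum>g\<in>G. r g * g) \<in> P}"

lemma frac_spanI: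
  "c \<in> R \<Longrightarrow> c \<noteq> 0 \<Longrightarrow> (\<And>g. g \<in> G \<Longrightarrow> r g \<in> R) \<Longrightarrow> c * h - (\<Sum>g\<in>G. r g * g) \<in> P \<Longrightarrow> h \<in> frac_span G"
  by (auto simp: frac_span_def)

lemma frac_spanE:
  assumes "h \<in> frac_span G"
  obtains c r where "c \<in> R" "c \<noteq> 0" "\<And>g. g \<in> G \<Longrightarrow> r g \<in> R" "c * h - (\<Sum>g\<in>G. r g * g) \<in> P"
  using assms by (auto simp: frac_span_def)

lemma frac_span_base: "finite G \<Longrightarrow> g \<in> G \<Longrightarrow> g \<in> frac_span G"
  by (rule frac_spanI[of 1 G "\<lambda>g'. if g' = g then 1 else 0"])
     (auto simp: R_one R_zero P_zero if_distrib[of "\<lambda>x. x * _"] cong: if_cong)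

lemma frac_span_ideal: "p \<in> P \<Longrightarrow> p \<in> frac_span G"
  by (rule frac_spanI[of 1 G "\<lambda>_. 0"]) (auto simp: R_one R_zero)

lemma frac_span_scale:
  assumes "a \<in> R" "h \<in> frac_span G"
  shows "a * h \<in> frac_span G"
proof -
  obtain c r where c: "c \<in> R" "c \<noteq> 0" "\<And>g. g \<in> G \<Longrightarrow> r g \<in> R" "c * h - (\<Sum>g\<in>G. r g * g) \<in> P"
    using assms(2) by (rule frac_spanE) blast
  have "a * (c * h - (\<Sum>g\<in>G. r g * g)) = c * (a * h) - (\<Sum>g\<in>G. (a * r g) * g)"
    by (simp add: right_diff_distrib sum_distrib_left mult_ac)
  then have "c * (a * h) - (\<Sum>g\<in>G. (a * r g) * g) \<in> P"
    using P_mult[of a, OF _ c(4)] assms(1) R_sub by auto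
  then show ?thesis using c assms(1) by (intro frac_spanI[of c]) (auto intro: R_mult)
qed

lemma frac_span_cancel:
  assumes "a \<in> R" "a \<noteq> 0" "a * h \<in> frac_span G"
  shows "h \<in> frac_span G"
proof -
  obtain c r where c: "c \<in> R" "c \<noteq> 0" "\<And>g. g \<in> G \<Longrightarrow> r g \<in> R" "c * (a * h) - (\<Sum>g\<in>G. r g * g) \<in> P"
    using assms(3) by (rule frac_spanE) blast
  show ?thesis
    by (rule frac_spanI[of "c * a" G r]) (use c assms(1,2) R_mult in \<open>simp_all add: mult.assoc\<close>)
qed

lemma frac_span_add:
  assumes "h \<in> frac_span G" "h' \<in> frac_span G"
  shows "h + h' \<in> frac_span G"
proof -
  obtain c r where c: "c \<in> R" "c \<noteq> 0" "\<And>g. g \<in> G \<Longrightarrow> r g \<in> R" "c * h - (\<Sum>g\<in>G. r g * g) \<in> P"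
    using assms(1) by (rule frac_spanE) blast
  obtain c' r' where c': "c' \<in> R" "c' \<noteq> 0" "\<And>g. g \<in> G \<Longrightarrow> r' g \<in> R" "c' * h' - (\<Sum>g\<in>G. r' g * g) \<in> P"
    using assms(2) by (rule frac_spanE) blast
  define s s' where "s = (\<Sum>g\<in>G. r g * g)" and "s' = (\<Sum>g\<in>G. r' g * g)"
  have sum: "(\<Sum>g\<in>G. (c' * r g + c * r' g) * g) = c' * s + c * s'"
    by (simp add: s_def s'_def sum.distrib sum_distrib_left distrib_right mult.assoc)
  have "c' * (c * h - s) + c * (c' * h' - s') \<in> P"
    using P_add[OF P_mult[OF subsetD[OF R_sub c'(1)] c(4)] P_mult[OF subsetD[OF R_sub c(1)] c'(4)]]
    by (simp only: s_def s'_def)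
  also have "c' * (c * h - s) + c * (c' * h' - s') = (c * c') * (h + h') - (c' * s + c * s')"
    by (simp add: algebra_simps)
  finally show ?thesis
    unfolding sum[symmetric]
    by (rule frac_spanI[rotated -1]) (simp_all add: c c' R_mult R_add)
qed

lemma frac_span_sum: "(\<And>i. i \<in> I \<Longrightarrow> f i \<in> frac_span G) \<Longrightarrow> sum f I \<in> frac_span G"
  by (induction I rule: infinite_finite_induct)
     (auto intro: frac_span_add frac_span_ideal[OF P_zero])

lemma frac_span_mult:
  assumes v: "v \<in> S" and G: "\<And>g. g \<in> G \<Longrightarrow> v * g \<in> frac_span G'" and h: "h \<in> frac_span G"
  shows "v * h \<in> frac_span G'"
proof -
  obtain c r where c: "c \<in> R" "c \<noteq> 0" "\<And>g. g \<in> G \<Longrightarrow> r g \<in> R" "c * h - (\<Sum>g\<in>G. r g * g) \<in> P"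
    using h by (rule frac_spanE) blast
  have "c * (v * h) = v * (c * h - (\<Sum>g\<in>G. r g * g)) + (\<Sum>g\<in>G. r g * (v * g))"
    by (simp add: right_diff_distrib sum_distrib_left mult_ac)
  moreover have "v * (c * h - (\<Sum>g\<in>G. r g * g)) \<in> frac_span G'"
    using P_mult[OF v c(4)] by (rule frac_span_ideal)
  moreover have "(\<Sum>g\<in>G. r g * (v * g)) \<in> frac_span G'"
    using c(3) G by (auto intro: frac_span_sum frac_span_scale)
  ultimately have "c * (v * h) \<in> frac_span G'" by (simp add: frac_span_add)
  then show ?thesis using c(1,2) frac_span_cancel by blast
qed

lemma S_power: "v \<in> S \<Longrightarrow> v ^ k \<in> S"
  by (induction k) (use R_one R_sub S_mult in auto)

definition algebraic_elt :: "'a \<Rightarrow> bool" where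
  "algebraic_elt v \<longleftrightarrow> (\<exists>d a. d > 0 \<and> (\<forall>k. a k \<in> R) \<and> a d \<noteq> 0 \<and> (\<Sum>k\<le>d. a k * v ^ k) \<in> P)"

text \<open>Adjoining finitely many algebraic elements gives a finite extension. For one more element \<open>v\<close>
  of degree \<open>d\<close>, the products \<open>g v\<^sup>k\<close> with \<open>k < d\<close> suffice, since the relation for \<open>v\<close> expresses a
  nonzero multiple of \<open>v\<^sup>d\<close> through lower powers.\<close>

lemma finite_spanning_set:
  assumes "finite W" "W \<subseteq> S" "\<And>w. w \<in> W \<Longrightarrow> algebraic_elt w"
  shows "\<exists>G. finite G \<and> G \<subseteq> S \<and> 1 \<in> G \<and> (\<forall>w\<in>W. \<forall>g\<in>G. w * g \<in> frac_span G)"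
  using assms
proof (induction W rule: finite_induct)
  case empty
  have "finite {1} \<and> {1} \<subseteq> S \<and> 1 \<in> {1} \<and> (\<forall>w\<in>{}. \<forall>g\<in>{1}. w * g \<in> frac_span {1})"
    using R_one R_sub by auto
  then show ?case by blast
next
  case (insert v W)
  have "\<exists>G. finite G \<and> G \<subseteq> S \<and> 1 \<in> G \<and> (\<forall>w\<in>W. \<forall>g\<in>G. w * g \<in> frac_span G)"
    by (rule insert.IH) (use insert.prems in auto)
  then obtain G where G: "finite G" "G \<subseteq> S" "1 \<in> G" "\<And>w g. w \<in> W \<Longrightarrow> g \<in> G \<Longrightarrow> w * g \<in> frac_span G"
    by blast
  have v: "v \<in> S" using insert by auto
  obtain d a where a: "d > 0" "\<And>k. a k \<in> R" "a d \<noteq> 0" "(\<Sum>k\<le>d. a k * v ^ k) \<in> P"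
    using insert.prems(2)[of v] unfolding algebraic_elt_def by auto
  define G' where "G' = (\<lambda>(g, k). g * v ^ k) ` (G \<times> {..<d})"
  have fin: "finite G'" using G by (simp add: G'_def)
  have base: "g * v ^ k \<in> frac_span G'" if "g \<in> G" "k < d" for g k
    using that by (intro frac_span_base fin) (auto simp: G'_def)
  have step: "g * v ^ k \<in> frac_span G'" if "g \<in> G" "k \<le> d" for g k
  proof (cases "k = d")
    case True
    have "g * (\<Sum>k\<le>d. a k * v ^ k) = a d * (g * v ^ d) + (\<Sum>k<d. a k * (g * v ^ k))"
    proof -
      have "{..d} = insert d {..<d}" by auto
      then show ?thesis by (simp add: sum_distrib_left distrib_left mult.left_commute)
    qed
    moreover have "g * (\<Sum>k\<le>d. a k * v ^ k) \<in> P" using P_mult a(4) G(2) that by blast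
    moreover have "(\<Sum>k<d. (- a k) * (g * v ^ k)) \<in> frac_span G'"
      by (rule frac_span_sum, rule frac_span_scale) (use base a(2) that(1) R_uminus in simp_all)
    ultimately have "a d * (g * v ^ d) + (\<Sum>k<d. a k * (g * v ^ k)) + (\<Sum>k<d. (- a k) * (g * v ^ k)) \<in> frac_span G'"
      by (metis frac_span_add frac_span_ideal)
    then have "a d * (g * v ^ d) \<in> frac_span G'" by (simp add: sum_negf)
    then show ?thesis using frac_span_cancel a True by blast
  qed (use that base in auto)
  have "w * h \<in> frac_span G'" if w: "w \<in> insert v W" and h: "h \<in> G'" for w h
  proof -
    obtain g k where g: "g \<in> G" "k < d" and hgk: "h = g * v ^ k" using h by (auto simp: G'_def)
    show ?thesis
    proof (cases "w = v")
      case True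
      have "w * h = g * v ^ Suc k" by (simp add: True hgk mult_ac)
      then show ?thesis using step[of g "Suc k"] g by simp
    next
      case False
      have "v ^ k * (w * g) \<in> frac_span G'"
      proof (rule frac_span_mult)
        show "v ^ k * g' \<in> frac_span G'" if "g' \<in> G" for g'
          using base[OF that g(2)] by (simp only: mult.commute)
        show "w * g \<in> frac_span G" using G(4) w False g(1) by blast
      qed (rule S_power[OF v])
      then show ?thesis by (simp add: hgk mult_ac)
    qed
  qed
  moreover have "G' \<subseteq> S" using G(2) S_power[OF v] S_mult by (auto simp: G'_def)
  moreover have "1 \<in> G'" using G(3) a(1) by (auto simp: G'_def intro!: rev_image_eqI[of "(1, 0)"])
  ultimately show ?case using fin by blast
qed

text \<open>More vectors than coordinates are linearly dependent. Gaussian elimination is done without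
  division, so that the coefficients of the relation stay in \<open>R\<close>.\<close>

lemma nontrivial_relation:
  assumes "finite G" "finite I" "card G < card I" "\<And>i g. i \<in> I \<Longrightarrow> g \<in> G \<Longrightarrow> r i g \<in> R"
  shows "\<exists>l. (\<forall>i\<in>I. l i \<in> R) \<and> (\<exists>i\<in>I. l i \<noteq> 0) \<and> (\<forall>g\<in>G. (\<Sum>i\<in>I. l i * r i g) = 0)"
  using assms
proof (induction G arbitrary: I r rule: finite_induct)
  case empty
  then obtain i where "i \<in> I" by fastforce
  then show ?case by (intro exI[of _ "\<lambda>_. 1"]) (auto simp: R_one)
next
  case (insert g0 G)
  show ?case
  proof (cases "\<forall>i\<in>I. r i g0 = 0")
    case True
    have "card G < card I" using insert by simp
    then have "\<exists>l. (\<forall>i\<in>I. l i \<in> R) \<and> (\<exists>i\<in>I. l i \<noteq> 0) \<and> (\<forall>g\<in>G. (\<Sum>i\<in>I. l i * r i g) = 0)"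
      by (intro insert.IH) (use insert.prems in auto)
    moreover have "(\<Sum>i\<in>I. l i * r i g0) = 0" for l using True by simp
    ultimately show ?thesis by (metis insert_iff)
  next
    case False
    then obtain j where j: "j \<in> I" "r j g0 \<noteq> 0" by blast
    define r' where "r' i g = r j g0 * r i g - r i g0 * r j g" for i g
    have "r' i g \<in> R" if "i \<in> I - {j}" "g \<in> G" for i g
      using that j(1) insert.prems(3) R_add[OF R_mult R_uminus[OF R_mult], of "r j g0" "r i g" "r i g0" "r j g"]
      by (simp add: r'_def)
    moreover have "card G < card (I - {j})" using insert j by simp
    moreover have "finite (I - {j})" using insert.prems(1) by simp
    ultimately have "\<exists>l. (\<forall>i\<in>I - {j}. l i \<in> R) \<and> (\<exists>i\<in>I - {j}. l i \<noteq> 0) \<and>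
        (\<forall>g\<in>G. (\<Sum>i\<in>I - {j}. l i * r' i g) = 0)"
      by (intro insert.IH)
    then obtain l where l: "\<forall>i\<in>I - {j}. l i \<in> R" "\<exists>i\<in>I - {j}. l i \<noteq> 0"
        "\<forall>g\<in>G. (\<Sum>i\<in>I - {j}. l i * r' i g) = 0"
      by blast
    define l' where "l' i = (if i = j then - (\<Sum>i\<in>I - {j}. l i * r i g0) else l i * r j g0)" for i
    have sum: "(\<Sum>i\<in>I. l' i * r i g) = (\<Sum>i\<in>I - {j}. l i * r' i g)" for g
    proof -
      have "(\<Sum>i\<in>I. l' i * r i g) = l' j * r j g + (\<Sum>i\<in>I - {j}. l' i * r i g)"
        using insert.prems(1) j(1) by (rule sum.remove)
      also have "(\<Sum>i\<in>I - {j}. l' i * r i g) = (\<Sum>i\<in>I - {j}. l i * r j g0 * r i g)"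
        by (rule sum.cong) (auto simp: l'_def)
      finally have "(\<Sum>i\<in>I. l' i * r i g)
          = l' j * r j g + (\<Sum>i\<in>I - {j}. l i * r j g0 * r i g)" .
      moreover have "(\<Sum>i\<in>I - {j}. l i * r' i g)
          = (\<Sum>i\<in>I - {j}. l i * r j g0 * r i g) - (\<Sum>i\<in>I - {j}. l i * r i g0) * r j g"
        by (simp add: r'_def right_diff_distrib sum_subtractf sum_distrib_right mult.assoc)
      ultimately show ?thesis by (simp add: l'_def)
    qed
    have zero: "(\<Sum>i\<in>I. l' i * r i g) = 0" if "g \<in> insert g0 G" for g
    proof (cases "g = g0")
      case True
      then show ?thesis unfolding sum by (simp add: r'_def mult.commute)
    next
      case False
      then show ?thesis using that l(3) by (simp add: sum)
    qed
    have Rsum: "(\<And>i. i \<in> A \<Longrightarrow> f i \<in> R) \<Longrightarrow> sum f A \<in> R" for A f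
      by (induction A rule: infinite_finite_induct) (auto intro: R_zero R_add)
    have "l' i \<in> R" if "i \<in> I" for i
    proof (cases "i = j")
      case True
      have "(\<Sum>i\<in>I - {j}. l i * r i g0) \<in> R"
        by (rule Rsum, rule R_mult) (use l(1) insert.prems(3) in auto)
      then show ?thesis using True by (simp add: l'_def R_uminus)
    next
      case False
      then show ?thesis using that l(1) insert.prems(3) j(1) by (simp add: l'_def R_mult)
    qed
    moreover have "\<exists>i\<in>I. l' i \<noteq> 0" using l(2) j by (auto simp: l'_def)
    ultimately show ?thesis using zero by blast
  qed
qed

text \<open>Elements of a finite extension are algebraic: the first \<open>card G + 1\<close> powers satisfy a
  relation.\<close>

lemma relation_of_powers:
  assumes G: "finite G" and f: "\<And>i. f ^ i \<in> frac_span G"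
  shows "\<exists>n a. (\<forall>k. a k \<in> R) \<and> (\<exists>k\<le>n. a k \<noteq> 0) \<and> (\<Sum>k\<le>n. a k * f ^ k) \<in> P"
proof -
  have "\<forall>i. \<exists>c r. c \<in> R \<and> c \<noteq> 0 \<and> (\<forall>g\<in>G. r g \<in> R) \<and> c * f ^ i - (\<Sum>g\<in>G. r g * g) \<in> P"
    using frac_spanE[OF f] by metis
  then obtain c r where c: "\<And>i. c i \<in> R" "\<And>i. c i \<noteq> 0" "\<And>i g. g \<in> G \<Longrightarrow> r i g \<in> R"
      "\<And>i. c i * f ^ i - (\<Sum>g\<in>G. r i g * g) \<in> P"
    by metis
  define n where "n = card G"
  obtain l where l: "\<forall>i\<in>{..n}. l i \<in> R" "\<exists>i\<in>{..n}. l i \<noteq> 0" "\<forall>g\<in>G. (\<Sum>i\<in>{..n}. l i * r i g) = 0"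
    using nontrivial_relation[of G "{..n}" r] G c(3) by (auto simp: n_def)
  define a where "a k = (if k \<le> n then l k * c k else 0)" for k
  have "(\<Sum>i\<le>n. l i * (\<Sum>g\<in>G. r i g * g)) = (\<Sum>g\<in>G. \<Sum>i\<le>n. l i * r i g * g)"
    by (subst sum.swap) (simp add: sum_distrib_left mult_ac)
  also have "\<dots> = 0" using l(3) by (simp add: sum_distrib_right[symmetric])
  finally have "(\<Sum>k\<le>n. a k * f ^ k) = (\<Sum>i\<le>n. l i * (c i * f ^ i - (\<Sum>g\<in>G. r i g * g)))"
    by (simp add: a_def right_diff_distrib sum_subtractf mult.assoc)
  moreover have Psum: "(\<And>i. i \<in> A \<Longrightarrow> h i \<in> P) \<Longrightarrow> sum h A \<in> P" for A :: "nat set" and h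
    by (induction A rule: infinite_finite_induct) (auto intro: P_zero P_add)
  have "(\<Sum>i\<le>n. l i * (c i * f ^ i - (\<Sum>g\<in>G. r i g * g))) \<in> P"
    using l(1) R_sub by (intro Psum P_mult c(4)) auto
  moreover have "\<forall>k. a k \<in> R" using l(1) c(1) by (auto simp: a_def intro: R_mult R_zero)
  moreover have "\<exists>k\<le>n. a k \<noteq> 0" using l(2) c(2) by (auto simp: a_def)
  ultimately show ?thesis by metis
qed

end

section \<open>Heights and independent variables\<close>

text \<open>The classes of the variables in \<open>U\<close> are algebraically independent in the residue ring
  of \<open>P\<close>.\<close>

definition independent_mod :: "('v, 'k::field) mpoly set \<Rightarrow> 'v set \<Rightarrow> bool" where
  "independent_mod P U \<longleftrightarrow> P \<inter> polys U \<subseteq> {0}"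

lemma polys_insert_expansion:
  assumes "p \<in> polys (insert v U)"
  shows "\<exists>d a. (\<forall>k. a k \<in> polys U) \<and> (\<forall>k>d. a k = 0) \<and> p = (\<Sum>k\<le>d. a k * pvar v ^ k)"
  using assms
proof (induction rule: polys_induct)
  case (const a)
  show ?case
    by (rule exI[of _ 0], rule exI[of _ "\<lambda>k. if k = 0 then const a else 0"])
       (auto simp: polys_closed)
next
  case (add p q)
  obtain d a where a: "\<forall>k. a k \<in> polys U" "\<forall>k>d. a k = 0" "p = (\<Sum>k\<le>d. a k * pvar v ^ k)"
    using add.IH(1) by blast
  obtain e b where b: "\<forall>k. b k \<in> polys U" "\<forall>k>e. b k = 0" "q = (\<Sum>k\<le>e. b k * pvar v ^ k)"
    using add.IH(2) by blast
  have "p = (\<Sum>k\<le>max d e. a k * pvar v ^ k)"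
    using a unfolding a(3) by (intro sum.mono_neutral_left) auto
  moreover have "q = (\<Sum>k\<le>max d e. b k * pvar v ^ k)"
    using b unfolding b(3) by (intro sum.mono_neutral_left) auto
  ultimately show ?case using a(1,2) b(1,2)
    by (intro exI[of _ "max d e"] exI[of _ "\<lambda>k. a k + b k"])
       (auto simp: polys_closed sum.distrib ring_distribs)
next
  case (var w p)
  obtain d a where a: "\<forall>k. a k \<in> polys U" "\<forall>k>d. a k = 0" "p = (\<Sum>k\<le>d. a k * pvar v ^ k)"
    using var.IH by blast
  show ?case
  proof (cases "w = v")
    case True
    have "(\<Sum>k\<le>Suc d. (case k of 0 \<Rightarrow> 0 | Suc k \<Rightarrow> a k) * pvar v ^ k) = pvar w * p"
      unfolding a(3) True sum.atMost_Suc_shift by (simp add: sum_distrib_left mult_ac)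
    then show ?thesis using a(1,2)
      by (intro exI[of _ "Suc d"] exI[of _ "\<lambda>k. case k of 0 \<Rightarrow> 0 | Suc k \<Rightarrow> a k"])
         (auto simp: polys_closed split: nat.split)
  next
    case False
    then show ?thesis using a var.hyps
      by (intro exI[of _ d] exI[of _ "\<lambda>k. pvar w * a k"])
         (auto simp: polys_closed sum_distrib_left mult_ac)
  qed
qed

text \<open>Suppose that no variable can be added to \<open>U\<close>. Then each variable, and therefore each polynomial, is
  algebraic over \<open>K[U]\<close> modulo \<open>P\<close>. Take a relation for an element \<open>f\<close> of \<open>Q\<close> outside \<open>P\<close> and cancel
  powers of \<open>f\<close>, which is possible as \<open>P\<close> is prime, until its constant coefficient is nonzero. This
  coefficient is congruent to a multiple of \<open>f\<close>, so it is a nonzero element of \<open>Q\<close> in \<open>K[U]\<close>.\<close>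

lemma independent_mod_exchange:
  fixes P Q :: "('v::linorder, 'k::field) mpoly set"
  assumes V: "finite V" and P: "primeideal P (poly_ring V)" and Q: "primeideal Q (poly_ring V)"
    and PQ: "P \<subset> Q" and U: "U \<subseteq> V" and ind: "independent_mod Q U"
  shows "\<exists>v\<in>V - U. independent_mod P (insert v U)"
proof (rule ccontr)
  assume contra: "\<not> ?thesis"
  note Pid = ideal_polysD[OF primeideal_polysD(1)[OF P]]
  note Qid = ideal_polysD[OF primeideal_polysD(1)[OF Q]]
  interpret subring_and_ideal "polys V" "polys U" P
    by unfold_locales (use polys_mono[OF U] in \<open>auto simp: polys_closed Pid\<close>)
  have alg: "algebraic_elt (pvar v)" if v: "v \<in> V - U" for v
  proof -
    obtain p where p: "p \<in> P" "p \<in> polys (insert v U)" "p \<noteq> 0"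
      using contra v by (auto simp: independent_mod_def)
    obtain d a where a: "\<And>k. a k \<in> polys U" "\<And>k. k > d \<Longrightarrow> a k = 0" "p = (\<Sum>k\<le>d. a k * pvar v ^ k)"
      using polys_insert_expansion[OF p(2)] by blast
    \<comment> \<open>the vanishing top coefficients are dropped: \<open>e\<close> is the degree in \<open>v\<close>\<close>
    define e where "e = Max {k. k \<le> d \<and> a k \<noteq> 0}"
    have "{k. k \<le> d \<and> a k \<noteq> 0} \<noteq> {}" using p(3) a(3) by (auto intro!: sum.neutral)
    then have "e \<in> {k. k \<le> d \<and> a k \<noteq> 0}" unfolding e_def by (intro Max_in) auto
    then have e: "e \<le> d" "a e \<noteq> 0" by auto
    have "a k = 0" if "k > e" "k \<le> d" for k
      using that Max_ge[of "{k. k \<le> d \<and> a k \<noteq> 0}" k] unfolding e_def by fastforce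
    then have pe: "p = (\<Sum>k\<le>e. a k * pvar v ^ k)"
      unfolding a(3) using e(1) by (intro sum.mono_neutral_right) auto
    have "e > 0"
    proof (rule ccontr)
      assume "\<not> e > 0"
      then have "p \<in> polys U" using pe a(1)[of 0] by simp
      then show False using p PQ ind by (auto simp: independent_mod_def)
    qed
    then show ?thesis using e a(1) p(1) pe unfolding algebraic_elt_def by blast
  qed
  have "\<exists>G. finite G \<and> G \<subseteq> polys V \<and> 1 \<in> G \<and> (\<forall>w\<in>pvar ` (V - U). \<forall>g\<in>G. w * g \<in> frac_span G)"
    by (rule finite_spanning_set) (use V alg in \<open>auto intro: polys_pvar\<close>)
  then obtain G where G: "finite G" "G \<subseteq> polys V" "1 \<in> G"
      "\<forall>w\<in>pvar ` (V - U). \<forall>g\<in>G. w * g \<in> frac_span G"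
    by blast
  have span: "p \<in> frac_span G" if "p \<in> polys V" for p
    using that
  proof (induction rule: polys_induct)
    case (const a)
    have "const a * 1 \<in> frac_span G"
      by (rule frac_span_scale[OF polys_const frac_span_base[OF G(1,3)]])
    then show ?case by simp
  next
    case (var v p)
    show ?case
    proof (cases "v \<in> U")
      case True
      then show ?thesis using var.IH by (intro frac_span_scale polys_pvar)
    next
      case False
      then have "pvar v * g \<in> frac_span G" if "g \<in> G" for g using G(4) var.hyps(1) that by blast
      then show ?thesis using frac_span_mult[OF polys_pvar[OF var.hyps(1)] _ var.IH] by blast
    qed
  qed (rule frac_span_add)
  obtain f where f: "f \<in> Q" "f \<notin> P" using PQ by blast
  have fV: "f \<in> polys V" using f Qid(1) by blast
  obtain n a where a: "\<And>k. a k \<in> polys U" "\<exists>k\<le>n. a k \<noteq> 0" "(\<Sum>k\<le>n. a k * f ^ k) \<in> P"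
    using relation_of_powers[OF G(1) span[OF polys_power[OF fV]]] by blast
  have aV: "a k \<in> polys V" for k using a(1) polys_mono[OF U] by blast
  \<comment> \<open>\<open>f\<close> to the power \<open>j\<close> is what can be cancelled from the relation\<close>
  define j where "j = (LEAST k. a k \<noteq> 0)"
  have j: "a j \<noteq> 0" "j \<le> n" using a(2) LeastI_ex[of "\<lambda>k. a k \<noteq> 0"] Least_le[of "\<lambda>k. a k \<noteq> 0"]
    unfolding j_def by (blast, meson le_trans)
  have zero: "a k = 0" if "k < j" for k using that not_less_Least unfolding j_def by blast
  define g where "g = (\<Sum>k\<in>{j<..n}. a k * f ^ (k - Suc j))"
  have gV: "g \<in> polys V" unfolding g_def by (intro polys_sum polys_mult aV polys_power fV)
  have "(\<Sum>k\<le>n. a k * f ^ k) = (\<Sum>k\<in>{j..n}. a k * f ^ k)"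
    using zero by (intro sum.mono_neutral_right) auto
  also have "{j..n} = insert j {j<..n}" using j by auto
  also have "(\<Sum>k\<in>insert j {j<..n}. a k * f ^ k) = a j * f ^ j + (\<Sum>k\<in>{j<..n}. a k * f ^ k)"
    by simp
  also have "(\<Sum>k\<in>{j<..n}. a k * f ^ k) = f ^ j * (f * g)"
    unfolding g_def sum_distrib_left
  proof (rule sum.cong)
    fix k assume "k \<in> {j<..n}"
    then have "k = j + Suc (k - Suc j)" by simp
    then have "f ^ k = f ^ j * (f * f ^ (k - Suc j))" by (metis power_add power_Suc)
    then show "a k * f ^ k = f ^ j * (f * (a k * f ^ (k - Suc j)))" by (simp add: mult_ac)
  qed simp
  finally have "f ^ j * (a j + f * g) \<in> P" using a(3) by (simp add: algebra_simps)
  moreover have "f ^ i \<notin> P" for i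
  proof (induction i)
    case 0
    then show ?case using primeideal_polysD(2)[OF P] by simp
  next
    case (Suc i)
    then show ?case using primeideal_polysD(3)[OF P fV polys_power[OF fV], of i] f(2) by auto
  qed
  ultimately have "a j + f * g \<in> P"
    using primeideal_polysD(3)[OF P polys_power[OF fV] polys_add[OF aV polys_mult[OF fV gV]]] by blast
  then have "a j + f * g \<in> Q" using PQ by blast
  moreover have "f * g \<in> Q" using Qid(4)[OF gV f(1)] by (simp add: mult.commute)
  ultimately have "a j \<in> Q" using Qid(5)[of "a j + f * g" "f * g"] by simp
  then show False using ind a(1) j(1) by (auto simp: independent_mod_def)
qed

definition prime_chain :: "('a, 'm) ring_scheme \<Rightarrow> nat \<Rightarrow> 'a set \<Rightarrow> bool" where
  "prime_chain R k P \<longleftrightarrow> (\<exists>Q. (\<forall>i\<le>k. primeideal (Q i) R) \<and> (\<forall>i<k. Q i \<subset> Q (Suc i)) \<and> Q k = P)"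

lemma prime_height_chain: "prime_height R P = Sup {enat k |k. prime_chain R k P}"
  by (simp add: prime_height_def prime_chain_def)

lemma prime_chain_0: "primeideal P R \<Longrightarrow> prime_chain R 0 P"
  by (auto simp: prime_chain_def)

lemma prime_chain_Suc:
  "prime_chain R (Suc k) Q \<longleftrightarrow> primeideal Q R \<and> (\<exists>P. prime_chain R k P \<and> P \<subset> Q)"
proof
  assume "prime_chain R (Suc k) Q"
  then obtain C where C: "\<forall>i\<le>Suc k. primeideal (C i) R" "\<forall>i<Suc k. C i \<subset> C (Suc i)" "C (Suc k) = Q"
    by (auto simp: prime_chain_def)
  then have "prime_chain R k (C k)" unfolding prime_chain_def by (intro exI[of _ C]) simp
  moreover have "C k \<subset> Q" "primeideal Q R" using C by auto
  ultimately show "primeideal Q R \<and> (\<exists>P. prime_chain R k P \<and> P \<subset> Q)" by blast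
next
  assume "primeideal Q R \<and> (\<exists>P. prime_chain R k P \<and> P \<subset> Q)"
  then obtain C where C: "\<forall>i\<le>k. primeideal (C i) R" "\<forall>i<k. C i \<subset> C (Suc i)" "C k \<subset> Q" "primeideal Q R"
    by (auto simp: prime_chain_def)
  then show "prime_chain R (Suc k) Q"
    unfolding prime_chain_def
    by (intro exI[of _ "C(Suc k := Q)"]) (auto simp: less_Suc_eq le_Suc_eq)
qed

lemma prime_chain_mono:
  assumes "prime_chain R k P" "P \<subseteq> Q" "primeideal Q R"
  shows "prime_chain R k Q"
proof (cases k)
  case 0
  then show ?thesis using assms prime_chain_0 by simp
next
  case (Suc j)
  then show ?thesis using assms unfolding Suc prime_chain_Suc by blast
qed

lemma prime_height_ge: "prime_chain R k P \<Longrightarrow> enat k \<le> prime_height R P"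
  unfolding prime_height_chain by (intro Sup_upper) auto

lemma prime_chain_le:
  fixes P :: "('v::linorder, 'k::field) mpoly set"
  assumes V: "finite V" and "prime_chain (poly_ring V) k P" "U \<subseteq> V" "independent_mod P U"
  shows "k + card U \<le> card V"
  using assms(2-)
proof (induction k arbitrary: P U)
  case 0
  then show ?case using V by (auto intro: card_mono)
next
  case (Suc k)
  then obtain P' where P': "prime_chain (poly_ring V) k P'" "P' \<subset> P" "primeideal P (poly_ring V)"
    unfolding prime_chain_Suc by blast
  then have "primeideal P' (poly_ring V)" by (auto simp: prime_chain_def)
  then obtain v where v: "v \<in> V - U" "independent_mod P' (insert v U)"
    using independent_mod_exchange[OF V _ P'(3,2) Suc.prems(2,3)] by blast
  then have "k + card (insert v U) \<le> card V" using Suc.IH[OF P'(1)] Suc.prems by blast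
  then show ?case using v finite_subset[OF Suc.prems(2) V] by simp
qed

lemma prime_height_le:
  fixes P :: "('v::linorder, 'k::field) mpoly set"
  assumes "finite V" "U \<subseteq> V" "independent_mod P U"
  shows "prime_height (poly_ring V) P \<le> enat (card V - card U)"
  unfolding prime_height_chain
  using prime_chain_le[OF assms(1) _ assms(2,3)] by (intro Sup_least) fastforce

section \<open>Prime ideals of labelled vertex sets\<close>

abbreviation edge_vars :: "nat set \<Rightarrow> edge_var set" where
  "edge_vars V \<equiv> XVar ` V \<union> YVar ` V"

definition minor :: "nat \<Rightarrow> nat \<Rightarrow> (edge_var, 'k::field) mpoly" where
  "minor i j = pvar (XVar i) * pvar (YVar j) - pvar (XVar j) * pvar (YVar i)"

text \<open>The target variables are pairs: \<open>(0, i)\<close> is the scaling factor of vertex \<open>i\<close>, while \<open>(1, c)\<close>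
  and \<open>(2, c)\<close> are the two coordinates shared by all vertices with label \<open>c\<close>. On the vertices of one
  label this is the parametrisation of the cone over a Segre variety, that is, of the matrices
  with two rows and rank at most one.\<close>

fun segre :: "nat set \<Rightarrow> (nat \<Rightarrow> nat) \<Rightarrow> edge_var \<Rightarrow> (nat \<times> nat, 'k::field) mpoly" where
  "segre U r (XVar i) = (if i \<in> U then pvar (0, i) * pvar (1, r i) else 0)"
| "segre U r (YVar i) = (if i \<in> U then pvar (0, i) * pvar (2, r i) else 0)"

definition component_prime :: "nat set \<Rightarrow> nat set \<Rightarrow> (nat \<Rightarrow> nat) \<Rightarrow> (edge_var, 'k::field) mpoly set" where
  "component_prime V U r = subst_kernel (edge_vars V) (segre U r)"

lemma pvar_neq_0: "pvar v \<noteq> (0 :: ('v, 'k::field) mpoly)"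
proof
  assume "pvar v = (0 :: ('v, 'k::field) mpoly)"
  then have "Poly_Mapping.lookup (pvar v :: ('v, 'k::field) mpoly) (Poly_Mapping.single v 1) = 0" by simp
  then show False by (simp add: pvar_def)
qed

lemma primeideal_component_prime: "primeideal (component_prime V U r) (edge_ring V)"
  unfolding component_prime_def edge_ring_def by (rule primeideal_subst_kernel)

lemma edge_vars_polys: "i \<in> V \<Longrightarrow> pvar (XVar i) \<in> polys (edge_vars V)"
    "i \<in> V \<Longrightarrow> pvar (YVar i) \<in> polys (edge_vars V)"
  by (auto intro: polys_pvar)

lemma minor_polys: "i \<in> V \<Longrightarrow> j \<in> V \<Longrightarrow> minor i j \<in> polys (edge_vars V)"
  unfolding minor_def by (intro polys_diff polys_mult edge_vars_polys)

lemma var_mem_component_prime: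
  assumes "i \<in> V"
  shows "pvar (XVar i) \<in> component_prime V U r \<longleftrightarrow> i \<notin> U"
    "pvar (YVar i) \<in> component_prime V U r \<longleftrightarrow> i \<notin> U"
  using assms by (auto simp: component_prime_def subst_kernel_def edge_vars_polys pvar_neq_0)

lemma minor_mem_component_prime:
  assumes "i \<in> V" "j \<in> V"
  shows "(minor i j :: (edge_var, 'k::field) mpoly) \<in> component_prime V U r \<longleftrightarrow> i \<notin> U \<or> j \<notin> U \<or> r i = r j"
proof -
  let ?m = "minor i j :: (edge_var, 'k) mpoly"
  have mem: "?m \<in> component_prime V U r \<longleftrightarrow> poly_subst (segre U r) ?m = 0"
    using assms by (simp add: component_prime_def subst_kernel_def minor_polys)
  show ?thesis
  proof (cases "i \<in> U \<and> j \<in> U \<and> r i \<noteq> r j")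
    case True
    define \<tau> :: "nat \<times> nat \<Rightarrow> (nat \<times> nat, 'k) mpoly"
      where "\<tau> w = (if w \<in> {(1, r j), (2, r i)} then 0 else 1)" for w
    have "poly_subst \<tau> (poly_subst (segre U r) ?m) = 1"
      using True by (simp add: minor_def poly_subst_diff poly_subst_mult \<tau>_def)
    then show ?thesis using True mem by (metis poly_subst_0 zero_neq_one)
  next
    case False
    then show ?thesis unfolding mem by (auto simp: minor_def poly_subst_diff poly_subst_mult mult_ac)
  qed
qed

subsection \<open>Independent variables\<close>

fun segre_exponent :: "(nat \<Rightarrow> nat) \<Rightarrow> edge_var \<Rightarrow> (nat \<times> nat \<Rightarrow>\<^sub>0 nat)" where
  "segre_exponent r (XVar i) = Poly_Mapping.single (0, i) 1 + Poly_Mapping.single (1, r i) 1"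
| "segre_exponent r (YVar i) = Poly_Mapping.single (0, i) 1 + Poly_Mapping.single (2, r i) 1"

definition segre_monom :: "(nat \<Rightarrow> nat) \<Rightarrow> (edge_var \<Rightarrow>\<^sub>0 nat) \<Rightarrow> (nat \<times> nat \<Rightarrow>\<^sub>0 nat)" where
  "segre_monom r m = (\<Sum>v\<in>Poly_Mapping.keys m. \<Sum>_<Poly_Mapping.lookup m v. segre_exponent r v)"

lemma single_power:
  "(Poly_Mapping.single e (1::'k::field)) ^ k = Poly_Mapping.single (\<Sum>_<k. e) 1"
  for e :: "'w \<Rightarrow>\<^sub>0 nat"
  by (induction k) (simp_all add: mult_single add.commute)

lemma prod_single:
  "(\<Prod>v\<in>A. Poly_Mapping.single (e v) (1::'k::field)) = Poly_Mapping.single (\<Sum>v\<in>A. e v) 1"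
  for e :: "'v \<Rightarrow> 'w \<Rightarrow>\<^sub>0 nat"
  by (induction A rule: infinite_finite_induct) (simp_all add: mult_single)

lemma segre_eq_single:
  "v \<in> edge_vars U \<Longrightarrow> segre U r v = Poly_Mapping.single (segre_exponent r v) (1::'k::field)"
  by (auto simp: pvar_def mult_single)

lemma monom_subst_segre:
  assumes "Poly_Mapping.keys m \<subseteq> edge_vars U"
  shows "monom_subst (segre U r) m = Poly_Mapping.single (segre_monom r m) (1::'k::field)"
proof -
  have "monom_subst (segre U r) m = (\<Prod>v\<in>Poly_Mapping.keys m.
      Poly_Mapping.single (\<Sum>_<Poly_Mapping.lookup m v. segre_exponent r v) (1::'k))"
    unfolding monom_subst_def
  proof (rule prod.cong)
    fix v assume "v \<in> Poly_Mapping.keys m"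
    then have "v \<in> edge_vars U" using assms by blast
    then show "segre U r v ^ Poly_Mapping.lookup m v
        = Poly_Mapping.single (\<Sum>_<Poly_Mapping.lookup m v. segre_exponent r v) (1::'k)"
      by (simp only: segre_eq_single single_power)
  qed simp
  then show ?thesis by (simp only: prod_single segre_monom_def)
qed

lemma lookup_segre_monom:
  assumes "finite U" "Poly_Mapping.keys m \<subseteq> edge_vars U"
  shows "Poly_Mapping.lookup (segre_monom r m) w = (\<Sum>i\<in>U.
      Poly_Mapping.lookup m (XVar i) * Poly_Mapping.lookup (segre_exponent r (XVar i)) w +
      Poly_Mapping.lookup m (YVar i) * Poly_Mapping.lookup (segre_exponent r (YVar i)) w)"
proof -
  let ?f = "\<lambda>v. Poly_Mapping.lookup m v * Poly_Mapping.lookup (segre_exponent r v) w"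
  have "Poly_Mapping.lookup (segre_monom r m) w = sum ?f (Poly_Mapping.keys m)"
    by (simp add: segre_monom_def lookup_sum)
  also have "\<dots> = sum ?f (edge_vars U)"
    using assms by (intro sum.mono_neutral_left) (auto simp: in_keys_iff)
  also have "\<dots> = sum ?f (XVar ` U) + sum ?f (YVar ` U)"
    using assms by (intro sum.union_disjoint) auto
  also have "\<dots> = (\<Sum>i\<in>U. ?f (XVar i) + ?f (YVar i))"
    by (simp add: sum.reindex inj_on_def sum.distrib)
  finally show ?thesis .
qed

text \<open>If at most one vertex per label has both its variables in \<open>W\<close>, a monomial in \<open>W\<close> can be
  read off from its image. The exponent of a scaling factor gives the degree of the monomial at
  that vertex, which determines both exponents unless the vertex has both variables in \<open>W\<close>. For such
  a vertex, subtract the contributions of the other vertices from the exponent of the first shared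
  coordinate.\<close>

lemma inj_on_segre_monom:
  assumes U: "finite U" and W: "W \<subseteq> edge_vars U"
    and trans: "\<And>i j. {XVar i, YVar i, XVar j, YVar j} \<subseteq> W \<Longrightarrow> r i = r j \<Longrightarrow> i = j"
  shows "inj_on (segre_monom r) {m. Poly_Mapping.keys m \<subseteq> W}"
proof (rule inj_onI)
  fix m m' assume m: "m \<in> {m. Poly_Mapping.keys m \<subseteq> W}" and m': "m' \<in> {m. Poly_Mapping.keys m \<subseteq> W}"
    and eq: "segre_monom r m = segre_monom r m'"
  have out: "Poly_Mapping.lookup m v = 0" "Poly_Mapping.lookup m' v = 0" if "v \<notin> W" for v
    using that m m' by (auto simp: in_keys_iff)
  have keys: "Poly_Mapping.keys m \<subseteq> edge_vars U" "Poly_Mapping.keys m' \<subseteq> edge_vars U"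
    using m m' W by auto
  have row: "Poly_Mapping.lookup n (XVar i) + Poly_Mapping.lookup n (YVar i)
      = Poly_Mapping.lookup (segre_monom r n) (0, i)"
    if "i \<in> U" "Poly_Mapping.keys n \<subseteq> edge_vars U" for n i
    using that U by (simp add: lookup_segre_monom lookup_add lookup_single when_def distrib_left sum.distrib
        if_distrib[of "\<lambda>x. _ * x"] cong: if_cong)
  have col: "(\<Sum>j\<in>U. if r j = c then Poly_Mapping.lookup n (XVar j) else 0)
      = Poly_Mapping.lookup (segre_monom r n) (1, c)"
    if "Poly_Mapping.keys n \<subseteq> edge_vars U" for n c
    using that U by (simp add: lookup_segre_monom lookup_add lookup_single when_def distrib_left sum.distrib
        if_distrib[of "\<lambda>x. _ * x"] cong: if_cong)
  have single: "Poly_Mapping.lookup m (XVar i) = Poly_Mapping.lookup m' (XVar i)"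
    if "i \<in> U" "\<not> {XVar i, YVar i} \<subseteq> W" for i
    using that row[OF that(1) keys(1)] row[OF that(1) keys(2)] eq out[of "XVar i"] out[of "YVar i"] by auto
  have X: "Poly_Mapping.lookup m (XVar i) = Poly_Mapping.lookup m' (XVar i)" if i: "i \<in> U" for i
  proof (cases "{XVar i, YVar i} \<subseteq> W")
    case True
    let ?g = "\<lambda>n j. if r j = r i then Poly_Mapping.lookup n (XVar j) else 0"
    have "sum (?g m) U = sum (?g m') U" using col keys eq by simp
    moreover have split: "sum (?g n) U = Poly_Mapping.lookup n (XVar i) + sum (?g n) (U - {i})" for n
      using U i by (subst sum.remove[of U i]) auto
    moreover have "sum (?g m) (U - {i}) = sum (?g m') (U - {i})"
    proof (rule sum.cong)
      fix j assume j: "j \<in> U - {i}"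
      then have "\<not> {XVar j, YVar j} \<subseteq> W" if "r j = r i" using trans[of i j] True that by auto
      then show "?g m j = ?g m' j" using single[of j] j by (cases "r j = r i") simp_all
    qed simp
    ultimately show ?thesis using split[of m] split[of m'] by linarith
  qed (use single i in blast)
  have Y: "Poly_Mapping.lookup m (YVar i) = Poly_Mapping.lookup m' (YVar i)" if "i \<in> U" for i
    using row[OF that keys(1)] row[OF that keys(2)] X[OF that] eq by simp
  show "m = m'"
  proof (rule poly_mapping_eqI)
    fix v show "Poly_Mapping.lookup m v = Poly_Mapping.lookup m' v"
    proof (cases "v \<in> edge_vars U")
      case True
      then show ?thesis using X Y by auto
    next
      case False
      then have "v \<notin> W" using W by blast
      then show ?thesis using out by simp
    qed
  qed
qed

lemma independent_mod_component_prime: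
  assumes U: "finite U" and W: "W \<subseteq> edge_vars U"
    and trans: "\<And>i j. {XVar i, YVar i, XVar j, YVar j} \<subseteq> W \<Longrightarrow> r i = r j \<Longrightarrow> i = j"
  shows "independent_mod (component_prime V U r :: (edge_var, 'k::field) mpoly set) W"
  unfolding independent_mod_def
proof safe
  fix p :: "(edge_var, 'k) mpoly"
  assume p: "p \<in> component_prime V U r" "p \<in> polys W"
  have keys: "Poly_Mapping.keys m \<subseteq> W" if "m \<in> Poly_Mapping.keys p" for m
    using p(2) that by (auto simp: polys_iff)
  have inj: "inj_on (segre_monom r) (Poly_Mapping.keys p)"
    by (rule inj_on_subset[OF inj_on_segre_monom[OF U W]]) (use trans keys in auto)
  have "0 = poly_subst (segre U r) p" using p(1) by (simp add: component_prime_def subst_kernel_def)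
  also have "\<dots> = (\<Sum>m\<in>Poly_Mapping.keys p. Poly_Mapping.single (segre_monom r m) (Poly_Mapping.lookup p m))"
    unfolding poly_subst_def
  proof (rule sum.cong)
    fix m assume "m \<in> Poly_Mapping.keys p"
    then have "Poly_Mapping.keys m \<subseteq> edge_vars U" using keys W by blast
    then show "const (Poly_Mapping.lookup p m) * monom_subst (segre U r) m
        = Poly_Mapping.single (segre_monom r m) (Poly_Mapping.lookup p m)"
      by (simp add: monom_subst_segre mult_single)
  qed simp
  finally have sum: "(\<Sum>m\<in>Poly_Mapping.keys p. Poly_Mapping.single (segre_monom r m) (Poly_Mapping.lookup p m)) = 0"
    by simp
  have "Poly_Mapping.lookup p m = 0" if m: "m \<in> Poly_Mapping.keys p" for m
  proof -
    have "0 = Poly_Mapping.lookup (\<Sum>m\<in>Poly_Mapping.keys p.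
        Poly_Mapping.single (segre_monom r m) (Poly_Mapping.lookup p m)) (segre_monom r m)"
      by (simp only: sum lookup_zero)
    also have "\<dots> = (\<Sum>m'\<in>Poly_Mapping.keys p. if m' = m then Poly_Mapping.lookup p m' else 0)"
      unfolding lookup_sum
      by (rule sum.cong) (use inj m in \<open>auto simp: lookup_single when_def inj_on_def\<close>)
    also have "\<dots> = Poly_Mapping.lookup p m" using m by simp
    finally show ?thesis by simp
  qed
  then show "p = 0" by (intro poly_mapping_eqI) (metis in_keys_iff lookup_zero)
qed

subsection \<open>Primes above\<close>

text \<open>Choose a base vertex in each label class. One of its variables is outside \<open>P\<close>, so the minors
  in \<open>P\<close> let every polynomial be rewritten, up to a factor outside \<open>P\<close>, into a polynomial in a set
  \<open>W\<close> consisting of both variables of the base vertices and one variable of every other vertex. The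
  rewriting takes place modulo \<open>P\<close> and modulo the kernel at the same time. So an element of the kernel
  is rewritten into an element of the kernel in the variables \<open>W\<close>, which is zero by independence,
  and hence lies in \<open>P\<close>.\<close>

lemma component_prime_subset:
  fixes P :: "(edge_var, 'k::field) mpoly set"
  assumes V: "finite V" and U: "U \<subseteq> V" and P: "primeideal P (edge_ring V)"
    and killed: "\<And>i. i \<in> V - U \<Longrightarrow> pvar (XVar i) \<in> P \<and> pvar (YVar i) \<in> P"
    and minors: "\<And>i j. i \<in> U \<Longrightarrow> j \<in> U \<Longrightarrow> r i = r j \<Longrightarrow> minor i j \<in> P"
    and alive: "\<And>i. i \<in> U \<Longrightarrow> \<not> (pvar (XVar i) \<in> P \<and> pvar (YVar i) \<in> P)"
  shows "component_prime V U r \<subseteq> P"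
proof
  let ?Q = "component_prime V U r :: (edge_var, 'k) mpoly set"
  note Pprime = primeideal_polysD[OF P[unfolded edge_ring_def]]
  note Pid = ideal_polysD[OF Pprime(1)]
  note Qid = ideal_polysD[OF primeideal_polysD(1)[OF primeideal_component_prime[of V U r, unfolded edge_ring_def]]]
  define b where "b c = (SOME i. i \<in> U \<and> r i = c)" for c
  have b: "b (r i) \<in> U \<and> r (b (r i)) = r i" if "i \<in> U" for i
    using someI[of "\<lambda>j. j \<in> U \<and> r j = r i" i] that unfolding b_def by blast
  \<comment> \<open>multiplying with the base variable outside \<open>P\<close> trades the variable of \<open>i\<close> other than \<open>z i\<close>\<close>
  define z where "z i = (if pvar (XVar (b (r i))) \<in> P then YVar i else XVar i)" for i
  define W where "W = (\<Union>i\<in>U. {XVar (b (r i)), YVar (b (r i)), z i})"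
  have WU: "W \<subseteq> edge_vars U" using b by (simp add: W_def z_def UN_subset_iff)
  have WV: "polys W \<subseteq> polys (edge_vars V)" using WU U by (intro polys_mono) blast
  have base: "i = b (r i)" if "XVar i \<in> W" "YVar i \<in> W" for i
  proof (rule ccontr)
    assume neq: "i \<noteq> b (r i)"
    have fixed: "k = b (r k)" if "k = b (r l)" "l \<in> U" for k l
      using that b by metis
    have "XVar i = z i" "YVar i = z i"
      using that fixed neq by (fastforce simp: W_def z_def split: if_splits)+
    then show False by (metis edge_var.distinct(1))
  qed
  have ind: "independent_mod ?Q W"
  proof (rule independent_mod_component_prime[OF finite_subset[OF U V] WU])
    fix i j assume "{XVar i, YVar i, XVar j, YVar j} \<subseteq> W" "r i = r j"
    then show "i = j" using base[of i] base[of j] by simp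
  qed
  define I where "I = P \<inter> ?Q"
  have I_zero: "0 \<in> I" using Pid(2) Qid(2) by (simp add: I_def)
  have I_add: "p + q \<in> I" if "p \<in> I" "q \<in> I" for p q
    using that Pid(3)[of p q] Qid(3)[of p q] by (simp add: I_def)
  have I_mult: "p * q \<in> I" if "p \<in> polys (edge_vars V)" "q \<in> I" for p q
    using that Pid(4)[of p q] Qid(4)[of p q] by (simp add: I_def)
  \<comment> \<open>\<open>p\<close> can be rewritten, up to the factor \<open>d\<close>, into the polynomial \<open>g\<close> in the variables \<open>W\<close>\<close>
  define red where "red p \<longleftrightarrow> (\<exists>d g. d \<in> polys W \<and> d \<notin> P \<and> g \<in> polys W \<and> d * p - g \<in> I)"
    for p :: "(edge_var, 'k) mpoly"
  have redI: "red p" if "d \<in> polys W" "d \<notin> P" "g \<in> polys W" "d * p - g \<in> I" for p d g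
    using that by (auto simp: red_def)
  have prod: "d * d' \<notin> P" if "d \<in> polys W" "d \<notin> P" "d' \<in> polys W" "d' \<notin> P" for d d'
    using that Pprime(3)[OF subsetD[OF WV] subsetD[OF WV], of d d'] by blast
  have red_var: "red (pvar v)" if v: "v \<in> edge_vars V" for v
  proof (cases "v \<in> W")
    case True
    show ?thesis
      by (rule redI[of 1 "pvar v"]) (simp_all add: True polys_1 polys_pvar Pprime(2) I_zero)
  next
    case False
    obtain i where i: "i \<in> V" "v = XVar i \<or> v = YVar i" using v by auto
    show ?thesis
    proof (cases "i \<in> U")
      case False
      then have "pvar v \<in> I" using i killed[of i] by (auto simp: I_def var_mem_component_prime)
      then show ?thesis by (intro redI[of 1 0]) (simp_all add: polys_0 polys_1 Pprime(2))
    next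
      case True
      define j where "j = b (r i)"
      have j: "j \<in> U" "r j = r i" "XVar j \<in> W" "YVar j \<in> W" "z i \<in> W"
        using True b[OF True] by (auto simp: j_def W_def)
      have m: "minor i j \<in> I" "minor j i \<in> I"
        using minors[OF True j(1)] minors[OF j(1) True] j(2) subsetD[OF U True] subsetD[OF U j(1)]
        by (simp_all add: I_def minor_mem_component_prime)
      show ?thesis
      proof (cases "pvar (XVar j) \<in> P")
        case True
        then have "z i = YVar i" by (simp add: z_def j_def)
        then have z: "YVar i \<in> W" "v = XVar i" using j(5) \<open>v \<notin> W\<close> i(2) by auto
        show ?thesis
        proof (rule redI)
          show "pvar (YVar j) \<notin> P" using alive[OF j(1)] True by blast
          show "pvar (XVar j) * pvar (YVar i) \<in> polys W" "pvar (YVar j) \<in> polys W"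
            using j z by (auto intro: polys_mult polys_pvar)
          show "pvar (YVar j) * pvar v - pvar (XVar j) * pvar (YVar i) \<in> I"
            using m(1) by (simp add: minor_def z(2) mult_ac)
        qed
      next
        case nP: False
        then have "z i = XVar i" by (simp add: z_def j_def)
        then have z: "XVar i \<in> W" "v = YVar i" using j(5) \<open>v \<notin> W\<close> i(2) by auto
        show ?thesis
        proof (rule redI)
          show "pvar (XVar j) \<notin> P" by (rule nP)
          show "pvar (XVar i) * pvar (YVar j) \<in> polys W" "pvar (XVar j) \<in> polys W"
            using j z by (auto intro: polys_mult polys_pvar)
          show "pvar (XVar j) * pvar v - pvar (XVar i) * pvar (YVar j) \<in> I"
            using m(2) by (simp add: minor_def z(2))
        qed
      qed
    qed
  qed
  have red: "red p" if "p \<in> polys (edge_vars V)" for p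
    using that
  proof (induction rule: polys_induct)
    case (const a)
    show ?case by (rule redI[of 1 "const a"]) (simp_all add: polys_1 polys_const Pprime(2) I_zero)
  next
    case (add p q)
    obtain d g where d: "d \<in> polys W" "d \<notin> P" "g \<in> polys W" "d * p - g \<in> I"
      using add.IH(1) by (auto simp: red_def)
    obtain d' g' where d': "d' \<in> polys W" "d' \<notin> P" "g' \<in> polys W" "d' * q - g' \<in> I"
      using add.IH(2) by (auto simp: red_def)
    have "d' * (d * p - g) + d * (d' * q - g') \<in> I"
      by (rule I_add[OF I_mult[OF subsetD[OF WV d'(1)] d(4)] I_mult[OF subsetD[OF WV d(1)] d'(4)]])
    also have "d' * (d * p - g) + d * (d' * q - g') = d * d' * (p + q) - (d' * g + d * g')"
      by (simp add: algebra_simps)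
    finally show ?case
      using redI[OF polys_mult[OF d(1) d'(1)] prod[OF d(1,2) d'(1,2)]
          polys_add[OF polys_mult[OF d'(1) d(3)] polys_mult[OF d(1) d'(3)]]] by blast
  next
    case (var v p)
    obtain d g where d: "d \<in> polys W" "d \<notin> P" "g \<in> polys W" "d * p - g \<in> I"
      using var.IH by (auto simp: red_def)
    obtain d' g' where d': "d' \<in> polys W" "d' \<notin> P" "g' \<in> polys W" "d' * pvar v - g' \<in> I"
      using red_var[OF var.hyps(1)] by (auto simp: red_def)
    have "(d * p) * (d' * pvar v - g') + g' * (d * p - g) \<in> I"
      by (rule I_add[OF I_mult[OF polys_mult[OF subsetD[OF WV d(1)] var.hyps(2)] d'(4)]
            I_mult[OF subsetD[OF WV d'(3)] d(4)]])
    also have "(d * p) * (d' * pvar v - g') + g' * (d * p - g) = d * d' * (pvar v * p) - g' * g"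
      by (simp add: algebra_simps)
    finally show ?case
      using redI[OF polys_mult[OF d(1) d'(1)] prod[OF d(1,2) d'(1,2)] polys_mult[OF d'(3) d(3)]] by blast
  qed
  fix p assume p: "p \<in> ?Q"
  then have pV: "p \<in> polys (edge_vars V)" using Qid(1) by blast
  then obtain d g where d: "d \<in> polys W" "d \<notin> P" "g \<in> polys W" "d * p - g \<in> I"
    using red[OF pV] by (auto simp: red_def)
  have dV: "d \<in> polys (edge_vars V)" using d WV by blast
  have "d * p - g \<in> ?Q" using d(4) by (simp add: I_def)
  then have "g \<in> ?Q" using Qid(5)[OF Qid(4)[OF dV p], of "d * p - g"] by simp
  then have "g = 0" using ind d(3) by (auto simp: independent_mod_def)
  then have "d * p \<in> P" using d(4) by (simp add: I_def)
  then show "p \<in> P" using Pprime(3)[OF dV pV] d(2) by blast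
qed

subsection \<open>Heights\<close>

lemma subst_kernel_subset:
  assumes "\<And>v. v \<in> V \<Longrightarrow> poly_subst \<tau> (\<sigma> v) = \<rho> v"
  shows "subst_kernel V \<sigma> \<subseteq> subst_kernel V \<rho>"
proof
  fix p assume p: "p \<in> subst_kernel V \<sigma>"
  then have "p \<in> polys V" by (simp add: subst_kernel_def)
  then have "poly_subst \<tau> (poly_subst \<sigma> p) = poly_subst \<rho> p" using assms by (rule poly_subst_comp)
  then show "p \<in> subst_kernel V \<rho>" using p by (simp add: subst_kernel_def)
qed

definition kill :: "'v set \<Rightarrow> 'v \<Rightarrow> ('v, 'k::field) mpoly" where
  "kill Z v = (if v \<in> Z then 0 else pvar v)"

text \<open>These primes, generated by variables, are the lower part of the chain below
  \<open>component_prime V U r\<close>.\<close>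

lemma prime_chain_kill:
  assumes "finite Z" "Z \<subseteq> V"
  shows "prime_chain (poly_ring V) (card Z) (subst_kernel V (kill Z :: 'v::linorder \<Rightarrow> ('v, 'k::field) mpoly))"
  using assms
proof (induction Z rule: finite_induct)
  case empty
  show ?case by (simp add: prime_chain_0 primeideal_subst_kernel)
next
  case (insert v Z)
  let ?K = "\<lambda>Z. subst_kernel V (kill Z :: 'v \<Rightarrow> ('v, 'k) mpoly)"
  have "?K Z \<subseteq> ?K (insert v Z)"
    by (rule subst_kernel_subset[of _ "kill {v}"]) (auto simp: kill_def)
  moreover have "pvar v \<in> ?K (insert v Z)" "pvar v \<notin> ?K Z"
    using insert by (auto simp: subst_kernel_def kill_def polys_pvar pvar_neq_0)
  ultimately have "?K Z \<subset> ?K (insert v Z)" by blast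
  then show ?case
    using insert by (auto simp: prime_chain_Suc primeideal_subst_kernel)
qed

lemma card_edge_vars: "finite T \<Longrightarrow> card (edge_vars T) = 2 * card T"
  by (subst card_Un_disjoint) (auto simp: card_image inj_on_def)

text \<open>Passing to fewer vertices and coarser labels is a further substitution: \<open>f\<close> renames the
  labels, and the scaling factors of the lost vertices become zero.\<close>

lemma component_prime_coarsen:
  assumes "\<And>i. i \<in> U \<Longrightarrow> i \<in> U' \<and> r i = f (r' i)"
  shows "component_prime V U' r' \<subseteq> component_prime V U r"
  unfolding component_prime_def
  by (rule subst_kernel_subset[of _ "\<lambda>(t, c). if t = 0 then (if c \<in> U then pvar (0, c) else 0) else pvar (t, f c)"])
     (use assms in \<open>auto simp: poly_subst_mult\<close>)

text \<open>With distinct labels no minor is imposed, and killing the variables outside \<open>U\<close> gives a chain of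
  length \<open>2 * card (V - U)\<close>. In general, split off a vertex from a label class: the finer labelling has
  one label more and gives a strictly smaller prime.\<close>

lemma prime_chain_component_prime:
  assumes V: "finite V" and U: "U \<subseteq> V"
  shows "prime_chain (edge_ring V) (2 * card V - card U - card (r ` U))
    (component_prime V U r :: (edge_var, 'k::field) mpoly set)"
proof -
  have finU: "finite U" using U V finite_subset by blast
  have "prime_chain (edge_ring V) (2 * card (V - U) + k) (component_prime V U r :: (edge_var, 'k) mpoly set)"
    if "card U = card (r ` U) + k" for k
    using that
  proof (induction k arbitrary: r)
    case 0
    have "prime_chain (poly_ring (edge_vars V)) (card (edge_vars (V - U)))
        (subst_kernel (edge_vars V) (kill (edge_vars (V - U)) :: _ \<Rightarrow> (edge_var, 'k) mpoly))"
      using V by (intro prime_chain_kill) auto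
    moreover have "subst_kernel (edge_vars V) (kill (edge_vars (V - U))) \<subseteq> component_prime V U r"
      unfolding component_prime_def
      by (rule subst_kernel_subset[of _ "segre U r"]) (auto simp: kill_def)
    ultimately have "prime_chain (poly_ring (edge_vars V)) (card (edge_vars (V - U)))
        (component_prime V U r :: (edge_var, 'k) mpoly set)"
      by (rule prime_chain_mono) (rule primeideal_component_prime[unfolded edge_ring_def])
    moreover have "card (edge_vars (V - U)) = 2 * card (V - U)" using V by (intro card_edge_vars) auto
    ultimately show ?case by (simp only: edge_ring_def add_0_right)
  next
    case (Suc k)
    then have "\<not> inj_on r U" by (metis card_image add_cancel_right_right nat.simps(3))
    then obtain i j where ij: "i \<in> U" "j \<in> U" "i \<noteq> j" "r i = r j" by (auto simp: inj_on_def)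
    obtain c where c: "c \<notin> r ` U" using ex_new_if_finite[of "r ` U"] finU by auto
    define r' where "r' = r(i := c)"
    have "r' ` U = insert c (r ` U)"
    proof -
      have "r j \<in> r ` (U - {i})" using ij by blast
      then have "insert (r i) (r ` (U - {i})) = r ` (U - {i})" using ij(4) by auto
      moreover have "U = insert i (U - {i})" using ij by auto
      ultimately have "r ` U = r ` (U - {i})" by (metis image_insert)
      then show ?thesis using ij by (auto simp: r'_def)
    qed
    then have "card U = card (r' ` U) + k" using Suc.prems c finU by simp
    then have "prime_chain (edge_ring V) (2 * card (V - U) + k) (component_prime V U r' :: (edge_var, 'k) mpoly set)"
      by (rule Suc.IH)
    moreover have "component_prime V U r' \<subseteq> component_prime V U r"
      by (rule component_prime_coarsen[where f = "id(c := r i)"]) (use c in \<open>auto simp: r'_def\<close>)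
    moreover have "(minor i j :: (edge_var, 'k) mpoly) \<in> component_prime V U r"
        "(minor i j :: (edge_var, 'k) mpoly) \<notin> component_prime V U r'"
      using ij U c by (auto simp: minor_mem_component_prime subset_iff r'_def)
    ultimately show ?case
      by (auto simp: prime_chain_Suc primeideal_component_prime)
  qed
  note chain = this
  have "card (r ` U) \<le> card U" using finU by (rule card_image_le)
  moreover have "card (V - U) = card V - card U" "card U \<le> card V"
    using V U finU by (auto simp: card_Diff_subset card_mono)
  ultimately have "2 * card (V - U) + (card U - card (r ` U)) = 2 * card V - card U - card (r ` U)"
      "card U = card (r ` U) + (card U - card (r ` U))"
    by linarith+
  then show ?thesis using chain by metis
qed

theorem prime_height_component_prime:
  assumes V: "finite V" and U: "U \<subseteq> V"
  shows "prime_height (edge_ring V) (component_prime V U r :: (edge_var, 'k::field) mpoly set)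
    = enat (2 * card V - card U - card (r ` U))"
proof (rule antisym)
  show "enat (2 * card V - card U - card (r ` U)) \<le> prime_height (edge_ring V) (component_prime V U r :: (edge_var, 'k) mpoly set)"
    using prime_chain_component_prime[OF V U] by (rule prime_height_ge)
  have finU: "finite U" using U V finite_subset by blast
  define b where "b = inv_into U r"
  have b: "b c \<in> U" "r (b c) = c" if "c \<in> r ` U" for c
    using that by (auto simp: b_def inv_into_into f_inv_into_f)
  have "inj_on b (r ` U)" using b by (metis inj_onI)
  define W where "W = XVar ` U \<union> YVar ` b ` r ` U"
  have "card W = card U + card (r ` U)"
  proof -
    have "card W = card (XVar ` U) + card (YVar ` b ` r ` U)"
      unfolding W_def using finU by (intro card_Un_disjoint) auto
    also have "card (YVar ` b ` r ` U) = card (r ` U)"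
      using \<open>inj_on b (r ` U)\<close> by (simp add: card_image inj_on_def)
    finally show ?thesis by (simp add: card_image inj_on_def)
  qed
  moreover have "independent_mod (component_prime V U r :: (edge_var, 'k) mpoly set) W"
  proof (rule independent_mod_component_prime[OF finU])
    have "YVar ` b ` r ` U \<subseteq> YVar ` U" using b(1) by auto
    then show "W \<subseteq> edge_vars U" unfolding W_def by blast
    show "i = j" if "{XVar i, YVar i, XVar j, YVar j} \<subseteq> W" "r i = r j" for i j
      using that b by (auto simp: W_def)
  qed
  moreover have "W \<subseteq> edge_vars V"
  proof -
    have "YVar ` b ` r ` U \<subseteq> YVar ` U" using b(1) by auto
    then show ?thesis unfolding W_def using U by blast
  qed
  ultimately show "prime_height (edge_ring V) (component_prime V U r :: (edge_var, 'k) mpoly set)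
      \<le> enat (2 * card V - card U - card (r ` U))"
    using prime_height_le[of "edge_vars V" W "component_prime V U r :: (edge_var, 'k) mpoly set"] V
    by (simp add: edge_ring_def card_edge_vars)
qed

section \<open>Primes over a binomial edge ideal\<close>

lemma minor_self [simp]: "minor i i = 0"
  by (simp add: minor_def)

lemma binomial_edge_ideal_subset_iff:
  assumes E: "\<Union>E \<subseteq> V" and P: "ideal P (edge_ring V :: (edge_var, 'k::field) mpoly ring)"
  shows "binomial_edge_ideal V E \<subseteq> P \<longleftrightarrow> (\<forall>i j. {i, j} \<in> E \<longrightarrow> minor i j \<in> P)"
proof -
  interpret cring "edge_ring V :: (edge_var, 'k) mpoly ring"
    unfolding edge_ring_def by (rule poly_ring_cring)
  let ?S = "{minor i j |i j. {i, j} \<in> E} :: (edge_var, 'k) mpoly set"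
  have J: "binomial_edge_ideal V E = Idl\<^bsub>edge_ring V\<^esub> ?S"
    by (simp add: binomial_edge_ideal_def minor_def)
  have "?S \<subseteq> carrier (edge_ring V)"
    using E by (auto simp: edge_ring_def intro!: minor_polys)
  then have "?S \<subseteq> Idl\<^bsub>edge_ring V\<^esub> ?S" by (rule genideal_self)
  then show ?thesis using genideal_minimal[OF P, of ?S] unfolding J by blast
qed

text \<open>Proportionality of columns is transitive through a nonzero column: both variables of \<open>k\<close>
  multiply the minor of \<open>i\<close> and \<open>j\<close> into the ideal of the other two minors.\<close>

lemma minor_trans:
  fixes P :: "(edge_var, 'k::field) mpoly set"
  assumes P: "primeideal P (edge_ring V)" and V: "i \<in> V" "j \<in> V" "k \<in> V"
    and alive: "\<not> (pvar (XVar k) \<in> P \<and> pvar (YVar k) \<in> P)"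
    and ij: "minor i k \<in> P" and jk: "minor k j \<in> P"
  shows "minor i j \<in> P"
proof -
  note Pprime = primeideal_polysD[OF P[unfolded edge_ring_def]]
  note Pid = ideal_polysD[OF Pprime(1)]
  have "pvar (XVar i) * minor k j + pvar (XVar j) * minor i k \<in> P"
    by (rule Pid(3)[OF Pid(4)[OF edge_vars_polys(1)[OF V(1)] jk] Pid(4)[OF edge_vars_polys(1)[OF V(2)] ij]])
  also have "pvar (XVar i) * minor k j + pvar (XVar j) * minor i k = pvar (XVar k) * (minor i j :: (edge_var, 'k) mpoly)"
    by (simp add: minor_def algebra_simps)
  finally have X: "pvar (XVar k) \<in> P \<or> minor i j \<in> P"
    by (rule Pprime(3)[OF edge_vars_polys(1)[OF V(3)] minor_polys[OF V(1,2)]])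
  have "pvar (YVar j) * minor i k + pvar (YVar i) * minor k j \<in> P"
    by (rule Pid(3)[OF Pid(4)[OF edge_vars_polys(2)[OF V(2)] ij] Pid(4)[OF edge_vars_polys(2)[OF V(1)] jk]])
  also have "pvar (YVar j) * minor i k + pvar (YVar i) * minor k j = pvar (YVar k) * (minor i j :: (edge_var, 'k) mpoly)"
    by (simp add: minor_def algebra_simps)
  finally have "pvar (YVar k) \<in> P \<or> minor i j \<in> P"
    by (rule Pprime(3)[OF edge_vars_polys(2)[OF V(3)] minor_polys[OF V(1,2)]])
  with X alive show ?thesis by blast
qed

text \<open>The vertices \<open>i\<close> whose column \<open>(x\<^sub>i, y\<^sub>i)\<close> is nonzero modulo \<open>P\<close>.\<close>

definition live_vertices :: "nat set \<Rightarrow> (edge_var, 'k::field) mpoly set \<Rightarrow> nat set" where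
  "live_vertices V P = {i \<in> V. \<not> (pvar (XVar i) \<in> P \<and> pvar (YVar i) \<in> P)}"

definition induced_edges :: "nat set set \<Rightarrow> nat set \<Rightarrow> (nat \<times> nat) set" where
  "induced_edges E U = {(i, j). i \<in> U \<and> j \<in> U \<and> {i, j} \<in> E}"

definition component :: "nat set set \<Rightarrow> nat set \<Rightarrow> nat \<Rightarrow> nat" where
  "component E U i = (LEAST j. (i, j) \<in> (induced_edges E U)\<^sup>*)"

lemma component_eq_iff: "component E U i = component E U j \<longleftrightarrow> (i, j) \<in> (induced_edges E U)\<^sup>*"
proof -
  have sym: "sym ((induced_edges E U)\<^sup>*)"
    by (intro sym_rtrancl) (auto simp: sym_def induced_edges_def insert_commute)
  have self: "(i, component E U i) \<in> (induced_edges E U)\<^sup>*" for i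
    unfolding component_def by (rule LeastI[of _ i]) simp
  show ?thesis
  proof
    assume "component E U i = component E U j"
    then show "(i, j) \<in> (induced_edges E U)\<^sup>*"
      using self[of i] self[of j] sym by (metis rtrancl_trans symD)
  next
    assume ij: "(i, j) \<in> (induced_edges E U)\<^sup>*"
    then have "(i, k) \<in> (induced_edges E U)\<^sup>* \<longleftrightarrow> (j, k) \<in> (induced_edges E U)\<^sup>*" for k
      using sym by (meson rtrancl_trans symD)
    then show "component E U i = component E U j" by (simp add: component_def)
  qed
qed

lemma component_edge: "{i, j} \<in> E \<Longrightarrow> i \<in> U \<Longrightarrow> j \<in> U \<Longrightarrow> component E U i = component E U j"
  unfolding component_eq_iff by (auto simp: induced_edges_def)

lemma binomial_edge_ideal_subset_component_prime:
  assumes "\<Union>E \<subseteq> V" "\<And>i j. {i, j} \<in> E \<Longrightarrow> i \<in> U \<Longrightarrow> j \<in> U \<Longrightarrow> r i = r j"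
  shows "binomial_edge_ideal V E \<subseteq> (component_prime V U r :: (edge_var, 'k::field) mpoly set)"
proof -
  have "ideal (component_prime V U r :: (edge_var, 'k) mpoly set) (edge_ring V)"
    using primeideal_component_prime by (rule primeideal.axioms(1))
  moreover have "minor i j \<in> (component_prime V U r :: (edge_var, 'k) mpoly set)" if "{i, j} \<in> E" for i j
    using that assms(1) assms(2)[OF that] by (subst minor_mem_component_prime) auto
  ultimately show ?thesis using binomial_edge_ideal_subset_iff[OF assms(1)] by blast
qed

lemma component_prime_subset_prime:
  fixes P :: "(edge_var, 'k::field) mpoly set"
  assumes V: "finite V" and E: "\<Union>E \<subseteq> V" and P: "primeideal P (edge_ring V)"
    and J: "binomial_edge_ideal V E \<subseteq> P"
  defines "U \<equiv> live_vertices V P"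
  shows "component_prime V U (component E U) \<subseteq> P"
proof (rule component_prime_subset[OF V _ P])
  show "U \<subseteq> V" by (auto simp: U_def live_vertices_def)
  show "pvar (XVar i) \<in> P \<and> pvar (YVar i) \<in> P" if "i \<in> V - U" for i
    using that by (auto simp: U_def live_vertices_def)
  show alive: "\<not> (pvar (XVar i) \<in> P \<and> pvar (YVar i) \<in> P)" if "i \<in> U" for i
    using that by (auto simp: U_def live_vertices_def)
  have edge: "minor i j \<in> P" if "{i, j} \<in> E" for i j
    using J that binomial_edge_ideal_subset_iff[OF E primeideal.axioms(1)[OF P]] by blast
  have zero: "0 \<in> P"
    using ideal_polysD(2)[OF primeideal_polysD(1)[OF P[unfolded edge_ring_def]]] .
  show "minor i j \<in> P" if i: "i \<in> U" and "component E U i = component E U j" for i j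
  proof -
    have "(i, j) \<in> (induced_edges E U)\<^sup>*" using that by (simp add: component_eq_iff)
    then show ?thesis
    proof (induction rule: rtrancl_induct)
      case base
      then show ?case using zero by simp
    next
      case (step k l)
      then have kl: "k \<in> U" "l \<in> U" "{k, l} \<in> E" by (auto simp: induced_edges_def)
      have UV: "U \<subseteq> V" by (auto simp: U_def live_vertices_def)
      show ?case
        by (rule minor_trans[OF P _ _ _ alive[OF kl(1)] step.IH edge[OF kl(3)]]) (use i kl UV in auto)
    qed
  qed
qed

lemma minimal_prime_eq_component_prime:
  fixes P :: "(edge_var, 'k::field) mpoly set"
  assumes V: "finite V" and E: "\<Union>E \<subseteq> V"
    and P: "P \<in> minimal_primes (edge_ring V) (binomial_edge_ideal V E)"
  defines "U \<equiv> live_vertices V P"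
  shows "P = component_prime V U (component E U)"
proof -
  have "component_prime V U (component E U) \<subseteq> P"
    unfolding U_def using P
    by (intro component_prime_subset_prime[OF V E]) (simp_all add: minimal_primes_def)
  moreover have "binomial_edge_ideal V E \<subseteq> (component_prime V U (component E U) :: (edge_var, 'k) mpoly set)"
    by (rule binomial_edge_ideal_subset_component_prime[OF E component_edge])
  ultimately show ?thesis
    using P primeideal_component_prime[of V U "component E U", where 'a = 'k]
    unfolding minimal_primes_def by blast
qed

text \<open>If the neighbours of \<open>v\<close> in \<open>U\<close> all lie in one component, then \<open>v\<close> can be restored with the
  label of that component, and the resulting prime is strictly smaller but still contains the
  binomial edge ideal.\<close>

lemma minimal_prime_cut_vertex:
  fixes P :: "(edge_var, 'k::field) mpoly set"
  assumes V: "finite V" and E: "\<Union>E \<subseteq> V"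
    and P: "P \<in> minimal_primes (edge_ring V) (binomial_edge_ideal V E)"
  defines "U \<equiv> live_vertices V P"
  assumes v: "v \<in> V - U"
  shows "\<exists>i j. i \<in> U \<and> j \<in> U \<and> {v, i} \<in> E \<and> {v, j} \<in> E \<and> component E U i \<noteq> component E U j"
proof (rule ccontr)
  assume contra: "\<not> ?thesis"
  then have same: "component E U i = component E U j"
    if "i \<in> U" "j \<in> U" "{v, i} \<in> E" "{v, j} \<in> E" for i j
    using that by blast
  \<comment> \<open>if \<open>v\<close> has no neighbour in \<open>U\<close>, then \<open>w\<close> is arbitrary, and any label for \<open>v\<close> is admissible\<close>
  define w where "w = (SOME i. i \<in> U \<and> {v, i} \<in> E)"
  have w: "w \<in> U \<and> {v, w} \<in> E" if "i \<in> U" "{v, i} \<in> E" for i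
    unfolding w_def by (rule someI[of _ i]) (use that in simp)
  have c: "component E U i = component E U w" if "i \<in> U" "{v, i} \<in> E" for i
    using same[OF that(1) _ that(2)] w[OF that] by blast
  define r where "r = (component E U)(v := component E U w)"
  let ?Q = "component_prime V (insert v U) r :: (edge_var, 'k) mpoly set"
  have "binomial_edge_ideal V E \<subseteq> ?Q"
  proof (rule binomial_edge_ideal_subset_component_prime[OF E])
    fix i j assume ij: "{i, j} \<in> E" "i \<in> insert v U" "j \<in> insert v U"
    consider "i = v" "j = v" | "i = v" "j \<in> U" | "i \<in> U" "j = v" | "i \<in> U" "j \<in> U"
      using ij by blast
    then show "r i = r j"
    proof cases
      case 1
      then show ?thesis by simp
    next
      case 2
      then show ?thesis using c[of j] ij(1) v by (simp add: r_def)
    next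
      case 3
      then show ?thesis using c[of i] ij(1) v by (simp add: r_def insert_commute)
    next
      case 4
      then show ?thesis using component_edge[OF ij(1)] v by (auto simp: r_def)
    qed
  qed
  moreover have "?Q \<subseteq> component_prime V U (component E U)"
    by (rule component_prime_coarsen[where f = id]) (use v in \<open>auto simp: r_def\<close>)
  then have "?Q \<subseteq> P"
    using minimal_prime_eq_component_prime[OF V E P] by (simp add: U_def)
  ultimately have "?Q = P"
    using P primeideal_component_prime[of V "insert v U" r, where 'a = 'k]
    unfolding minimal_primes_def by blast
  moreover have "pvar (XVar v) \<in> P" using v by (auto simp: U_def live_vertices_def)
  moreover have "pvar (XVar v) \<notin> ?Q" using v by (simp add: var_mem_component_prime)
  ultimately show False by simp
qed

text \<open>Map each component to the position just before its first vertex on the path. This position is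
  the start \<open>0\<close> or that of a deleted vertex, since two consecutive vertices of \<open>U\<close> lie in the
  same component.\<close>

lemma card_components_le_of_path:
  assumes V: "finite V" and U: "U \<subseteq> V" and q: "bij_betw q {1..N} V"
    and path: "\<And>k. 1 \<le> k \<Longrightarrow> k < N \<Longrightarrow> {q k, q (Suc k)} \<in> E"
  shows "card (component E U ` U) \<le> Suc (card (V - U))"
proof -
  define T where "T = {k \<in> {1..N}. q k \<in> V - U}"
  have finT: "finite T" by (simp add: T_def)
  have "inj_on q T"
    by (rule inj_on_subset[OF bij_betw_imp_inj_on[OF q]]) (auto simp: T_def)
  then have "card T = card (q ` T)" by (simp add: card_image)
  also have "\<dots> \<le> card (V - U)" using V by (intro card_mono) (auto simp: T_def)
  finally have T: "card (insert 0 T) \<le> Suc (card (V - U))"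
    using finT by (simp add: card_insert_if)
  define pos where "pos c k \<longleftrightarrow> k \<in> {1..N} \<and> q k \<in> U \<and> component E U (q k) = c" for c k
  define first where "first c = (LEAST k. pos c k)" for c
  have first: "pos c (first c)" if c: "c \<in> component E U ` U" for c
  proof -
    obtain i where i: "i \<in> U" "component E U i = c" using c by blast
    then have "i \<in> q ` {1..N}" using q U by (auto simp: bij_betw_def)
    then obtain k where "pos c k" using i by (auto simp: pos_def)
    then show ?thesis unfolding first_def by (rule LeastI)
  qed
  have "inj_on (\<lambda>c. first c - 1) (component E U ` U)"
  proof (rule inj_onI)
    fix c d assume c: "c \<in> component E U ` U" and d: "d \<in> component E U ` U" and eq: "first c - 1 = first d - 1"
    have "first c = first d" using first[OF c] first[OF d] eq by (auto simp: pos_def)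
    then show "c = d" using first[OF c] first[OF d] by (simp add: pos_def)
  qed
  moreover have "(\<lambda>c. first c - 1) ` component E U ` U \<subseteq> insert 0 T"
  proof
    fix k assume "k \<in> (\<lambda>c. first c - 1) ` component E U ` U"
    then obtain c where c: "c \<in> component E U ` U" "k = first c - 1" by blast
    have f: "pos c (Suc k)" using first[OF c(1)] c(2) by (simp add: pos_def)
    show "k \<in> insert 0 T"
    proof (cases "k = 0")
      case False
      then have k: "1 \<le> k" "k < N" using f by (auto simp: pos_def)
      then have qk: "q k \<in> V" using q by (auto simp: bij_betw_def)
      have "q k \<notin> U"
      proof
        assume qU: "q k \<in> U"
        then have "component E U (q k) = component E U (q (Suc k))"
          using f by (intro component_edge path k) (auto simp: pos_def)
        then have "pos c k" using f qU k by (simp add: pos_def)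
        then have "first c \<le> k" unfolding first_def by (rule Least_le)
        then show False using c(2) False by simp
      qed
      then show ?thesis using k qk by (auto simp: T_def)
    qed simp
  qed
  ultimately have "card (component E U ` U) \<le> card (insert 0 T)"
    by (intro card_inj_on_le) (auto simp: T_def)
  then show ?thesis using T by simp
qed

section \<open>The crown graph\<close>

lemma crown_edges_iff:
  "{a, b} \<in> crown_edges n \<longleftrightarrow> (\<exists>i\<in>{1..n}. \<exists>j\<in>{1..n}. i \<noteq> j \<and>
      (a = 2 * i - 1 \<and> b = 2 * j \<or> b = 2 * i - 1 \<and> a = 2 * j))"
  unfolding crown_edges_def mem_Collect_eq doubleton_eq_iff by blast

lemma crown_edges_Union: "\<Union>(crown_edges n) \<subseteq> crown_vertices n"
  using simple_graph_crown[of n] by (auto simp: simple_graph_def)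

lemma finite_crown_vertices: "finite (crown_vertices n)" and card_crown_vertices: "card (crown_vertices n) = 2 * n"
  by (simp_all add: crown_vertices_def)

text \<open>The path visits \<open>3, 2, 5, 4, 7, 6, \<dots>, 2n - 1, 2n - 2, 1, 2n\<close>: the even vertices stay at
  their positions, and the odd ones are shifted cyclically by one place among themselves, so that they
  are never next to their partners in the other part.\<close>

lemma crown_hamiltonian_path:
  assumes n: "n \<ge> 3"
  defines "q \<equiv> \<lambda>k. if even k then k else if k = 2 * n - 1 then 1 else k + 2"
  shows "bij_betw q {1..2 * n} (crown_vertices n)"
    and "\<And>k. 1 \<le> k \<Longrightarrow> k < 2 * n \<Longrightarrow> {q k, q (Suc k)} \<in> crown_edges n"
proof -
  have last: "2 * i + 1 = 2 * n - 1 \<longleftrightarrow> i = n - 1" for i using n by presburger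
  have q_even: "q (2 * i) = 2 * i" for i by (simp add: q_def)
  \<comment> \<open>position \<open>2i + 1\<close> holds the vertex with index \<open>s i\<close> of the odd part\<close>
  define s where "s i = (if i = n - 1 then 1 else i + 2)" for i
  have q_odd: "q (2 * i + 1) = 2 * s i - 1" for i
    unfolding q_def s_def last by simp
  have s: "1 \<le> s i" "s i \<le> n" "s i \<noteq> i" "s i \<noteq> i + 1" if "i < n" for i
    unfolding s_def using that n by (cases "i = n - 1"; simp)+
  have inj_s: "s i = s j \<Longrightarrow> i = j" for i j
    unfolding s_def by (cases "i = n - 1"; cases "j = n - 1"; simp)
  have into: "q ` {1..2 * n} \<subseteq> {1..2 * n}"
  proof
    fix y assume "y \<in> q ` {1..2 * n}"
    then obtain k where k: "1 \<le> k" "k \<le> 2 * n" and y: "y = q k" by auto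
    show "y \<in> {1..2 * n}"
    proof (cases "even k")
      case True
      then show ?thesis using k q_even by (auto simp: y elim: evenE)
    next
      case False
      then obtain i where i: "k = 2 * i + 1" by (rule oddE)
      then have "i < n" using k(2) by linarith
      then have "1 \<le> 2 * s i - 1" "2 * s i - 1 \<le> 2 * n" using s[of i] by linarith+
      then show ?thesis unfolding y i q_odd by simp
    qed
  qed
  have inj: "inj_on q {1..2 * n}"
  proof (rule inj_onI)
    fix k l assume kl: "k \<in> {1..2 * n}" "l \<in> {1..2 * n}" "q k = q l"
    have parity: "even (q m) \<longleftrightarrow> even m" for m
      by (simp add: q_def)
    have same: "even k \<longleftrightarrow> even l" using parity[of k] parity[of l] kl(3) by simp
    show "k = l"
    proof (cases "even k")
      case True
      then show ?thesis using kl(3) same by (simp add: q_def)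
    next
      case False
      then obtain i j where ij: "k = 2 * i + 1" "l = 2 * j + 1" using same by (meson oddE)
      then have "i < n" "j < n" using kl(1,2) by auto
      moreover have "2 * s i - 1 = 2 * s j - 1" using kl(3) unfolding ij q_odd .
      ultimately have "s i = s j" using s(1)[of i] s(1)[of j] by linarith
      then show ?thesis using inj_s ij by simp
    qed
  qed
  show "bij_betw q {1..2 * n} (crown_vertices n)"
    unfolding bij_betw_def crown_vertices_def
    using endo_inj_surj[OF finite_atLeastAtMost into inj] inj by blast
  have edge: "{2 * a - 1, 2 * b} \<in> crown_edges n" if "1 \<le> a" "a \<le> n" "1 \<le> b" "b \<le> n" "a \<noteq> b" for a b
    unfolding crown_edges_def using that by fastforce
  fix k assume k: "1 \<le> k" "k < 2 * n"
  show "{q k, q (Suc k)} \<in> crown_edges n"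
  proof (cases "even k")
    case True
    then obtain i where i: "k = 2 * i" by (rule evenE)
    then have lt: "1 \<le> i" "i < n" using k by linarith+
    have "{q k, q (Suc k)} = {2 * s i - 1, 2 * i}"
      using q_even[of i] q_odd[of i] by (simp add: i insert_commute)
    then show ?thesis using edge[of "s i" i] s[OF lt(2)] lt by simp
  next
    case False
    then obtain i where i: "k = 2 * i + 1" by (rule oddE)
    then have lt: "i < n" using k by linarith
    have "{q k, q (Suc k)} = {2 * s i - 1, 2 * (i + 1)}"
      using q_even[of "i + 1"] q_odd[of i] by (simp add: i)
    then show ?thesis using edge[of "s i" "i + 1"] s[OF lt] lt by simp
  qed
qed

lemma crown_non_neighbours:
  assumes d: "d \<in> crown_vertices n"
  shows "Suc n \<le> card {v \<in> crown_vertices n. {v, d} \<notin> crown_edges n}"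
proof -
  obtain i where i: "i \<in> {1..n}" "d = 2 * i - 1 \<or> d = 2 * i"
  proof (cases "even d")
    case True
    then show ?thesis using d that[of "d div 2"] by (auto simp: crown_vertices_def elim!: evenE)
  next
    case False
    then show ?thesis using d that[of "Suc (d div 2)"] by (auto simp: crown_vertices_def elim!: oddE)
  qed
  define N where "N = (if d = 2 * i then insert (2 * i - 1) ((\<lambda>k. 2 * k) ` {1..n})
    else insert (2 * i) ((\<lambda>k. 2 * k - 1) ` {1..n}))"
  have "card N = Suc n"
  proof (cases "d = 2 * i")
    case True
    have "2 * i - 1 \<notin> (\<lambda>k. 2 * k) ` {1..n}" using i(1) by auto presburger
    moreover have "card ((\<lambda>k. 2 * k) ` {1..n}) = n" by (simp add: card_image inj_on_def)
    ultimately show ?thesis using True by (simp add: N_def)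
  next
    case False
    have "2 * i \<notin> (\<lambda>k. 2 * k - 1) ` {1..n}" using i(1) by auto presburger
    moreover have "card ((\<lambda>k. 2 * k - 1) ` {1..n}) = n"
      by (subst card_image) (auto simp: inj_on_def)
    ultimately show ?thesis using False by (simp add: N_def)
  qed
  moreover have "N \<subseteq> {v \<in> crown_vertices n. {v, d} \<notin> crown_edges n}"
  proof
    fix v assume v: "v \<in> N"
    have "v \<in> crown_vertices n" using v i(1) by (auto simp: N_def crown_vertices_def split: if_splits)
    moreover have "{v, d} \<notin> crown_edges n"
    proof
      assume "{v, d} \<in> crown_edges n"
      then obtain a b where ab: "a \<in> {1..n}" "b \<in> {1..n}" "a \<noteq> b"
        "v = 2 * a - 1 \<and> d = 2 * b \<or> d = 2 * a - 1 \<and> v = 2 * b"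
        unfolding crown_edges_iff by blast
      have par: "2 * k - 1 \<noteq> 2 * l" if "k \<ge> 1" for k l :: nat using that by presburger
      show False
      proof (cases "d = 2 * i")
        case True
        then have "v = 2 * a - 1" "b = i" using ab par[of a i] by auto
        then show False using v True ab par i by (auto simp: N_def)
      next
        case False
        then have d': "d = 2 * i - 1" using i(2) by simp
        then have "v = 2 * b" "a = i" using ab par[of i b] i(1) by auto
        then show False using v False ab par par[symmetric] i d' by (auto simp: N_def)
      qed
    qed
    ultimately show "v \<in> {v \<in> crown_vertices n. {v, d} \<notin> crown_edges n}" by blast
  qed
  then have "card N \<le> card {v \<in> crown_vertices n. {v, d} \<notin> crown_edges n}"
    using finite_crown_vertices by (intro card_mono) auto
  ultimately show ?thesis by simp
qed

text \<open>If \<open>card U\<close> and the number of components add up to at most five, there is a deleted vertex,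
  so by the cut vertex property there are exactly two components and at most three vertices, and
  one component is a single vertex \<open>d\<close>. All deleted vertices are then adjacent to \<open>d\<close>, so the
  non-neighbours of \<open>d\<close> all lie in \<open>U\<close>; but there are at least four of them.\<close>

lemma crown_minimal_prime_height:
  fixes P :: "(edge_var, 'k::field) mpoly set"
  assumes n: "n \<ge> 3"
    and P: "P \<in> minimal_primes (edge_ring (crown_vertices n))
      (binomial_edge_ideal (crown_vertices n) (crown_edges n))"
  shows "prime_height (edge_ring (crown_vertices n)) P \<le> enat (4 * n - 6)"
proof -
  let ?V = "crown_vertices n" and ?E = "crown_edges n"
  define U where "U = live_vertices ?V P"
  define r where "r = component ?E U"
  have U: "U \<subseteq> ?V" by (auto simp: U_def live_vertices_def)
  have finU: "finite U" using U finite_crown_vertices finite_subset by blast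
  have PU: "P = component_prime ?V U r"
    unfolding r_def U_def
    by (rule minimal_prime_eq_component_prime[OF finite_crown_vertices crown_edges_Union P])
  have cut: "\<exists>i j. i \<in> U \<and> j \<in> U \<and> {v, i} \<in> ?E \<and> {v, j} \<in> ?E \<and> r i \<noteq> r j" if "v \<in> ?V - U" for v
    using minimal_prime_cut_vertex[OF finite_crown_vertices crown_edges_Union P] that
    unfolding r_def U_def by blast
  have "6 \<le> card U + card (r ` U)"
  proof (rule ccontr)
    assume small: "\<not> ?thesis"
    have le: "card (r ` U) \<le> card U" using finU by (rule card_image_le)
    have "card U < card ?V" using small n by (simp add: card_crown_vertices)
    then obtain v where "v \<in> ?V - U" using U finU by (metis DiffI card_mono finite_crown_vertices not_less subsetI)
    then obtain i j where ij: "i \<in> U" "j \<in> U" "r i \<noteq> r j" using cut by blast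
    have "card {r i, r j} \<le> card (r ` U)" using ij finU by (intro card_mono) auto
    then have two: "card (r ` U) = 2" using ij small le by simp
    then have rU: "r ` U = {r i, r j}"
      using ij finU by (intro card_subset_eq[symmetric]) auto
    define A where "A k = {l \<in> U. r l = r k}" for k
    have "U = A i \<union> A j" using rU by (auto simp: A_def)
    moreover have "A i \<inter> A j = {}" using ij by (auto simp: A_def)
    ultimately have "card U = card (A i) + card (A j)"
      using finU by (metis card_Un_disjoint finite_Un)
    moreover have "card (A i) \<noteq> 0" "card (A j) \<noteq> 0"
      using ij finU by (auto simp: A_def)
    ultimately have "card (A i) = 1 \<or> card (A j) = 1" using small two by linarith
    then obtain d where d: "d \<in> {i, j}" "card (A d) = 1" by blast
    then have dU: "d \<in> U" using ij by blast
    then have "d \<in> A d" by (simp add: A_def)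
    then have Ad: "A d = {d}" using d(2) by (metis card_1_singletonE singletonD)
    have "{v, d} \<in> ?E" if v: "v \<in> ?V - U" for v
    proof -
      obtain k l where kl: "k \<in> U" "l \<in> U" "{v, k} \<in> ?E" "{v, l} \<in> ?E" "r k \<noteq> r l"
        using cut[OF v] by blast
      have "r k \<in> {r i, r j}" "r l \<in> {r i, r j}" using kl rU by blast+
      then have "r k = r d \<or> r l = r d" using kl(5) d(1) by auto
      then have "k = d \<or> l = d" using Ad kl by (auto simp: A_def)
      then show ?thesis using kl by blast
    qed
    then have "{v \<in> ?V. {v, d} \<notin> ?E} \<subseteq> U" by blast
    then have "Suc n \<le> card U"
      using crown_non_neighbours[of d n] dU U card_mono[OF finU] by (meson order_trans subsetD)
    then show False using small two n by simp
  qed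
  then show ?thesis
    unfolding PU prime_height_component_prime[OF finite_crown_vertices U]
    by (simp add: card_crown_vertices)
qed

text \<open>The vertices \<open>1, 2, 3, 4\<close> induce the two disjoint edges \<open>{1, 4}\<close> and \<open>{2, 3}\<close>. Every further
  vertex \<open>v\<close> is adjacent to both \<open>1\<close> and \<open>3\<close> or to both \<open>2\<close> and \<open>4\<close>. If the variables of \<open>v\<close> were not
  both in a prime \<open>Q\<close> above the edge ideal, then \<open>Q\<close> would contain a minor across the two edges, so
  \<open>Q\<close> could not be contained in the prime of this configuration.\<close>

lemma crown_extremal_minimal_prime:
  assumes n: "n \<ge> 3"
  defines "P \<equiv> component_prime (crown_vertices n) {1, 2, 3, 4} (\<lambda>i. if i \<in> {1, 4} then 0 else 1)
      :: (edge_var, 'k::field) mpoly set"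
  shows "P \<in> minimal_primes (edge_ring (crown_vertices n))
      (binomial_edge_ideal (crown_vertices n) (crown_edges n))"
    and "prime_height (edge_ring (crown_vertices n)) P = enat (4 * n - 6)"
proof -
  let ?V = "crown_vertices n" and ?E = "crown_edges n"
  let ?U = "{1, 2, 3, 4} :: nat set" and ?r = "\<lambda>i::nat. if i \<in> {1, 4} then 0 else 1 :: nat"
  have U: "?U \<subseteq> ?V" using n by (auto simp: crown_vertices_def)
  have r: "?r ` ?U = {0, 1}" by auto
  show "prime_height (edge_ring ?V) P = enat (4 * n - 6)"
    unfolding P_def prime_height_component_prime[OF finite_crown_vertices U] r
    by (simp add: card_crown_vertices)
  have edge_in: "{2 * i - 1, 2 * j} \<in> ?E" if "1 \<le> i" "i \<le> n" "1 \<le> j" "j \<le> n" "i \<noteq> j" for i j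
    unfolding crown_edges_def using that by fastforce
  have J: "binomial_edge_ideal ?V ?E \<subseteq> P"
    unfolding P_def
  proof (rule binomial_edge_ideal_subset_component_prime[OF crown_edges_Union])
    fix a b assume ab: "{a, b} \<in> ?E" "a \<in> ?U" "b \<in> ?U"
    obtain i j where ij: "1 \<le> i" "1 \<le> j" "i \<noteq> j"
        "a = 2 * i - 1 \<and> b = 2 * j \<or> b = 2 * i - 1 \<and> a = 2 * j"
      using ab(1) unfolding crown_edges_iff by (meson atLeastAtMost_iff)
    have "a \<le> 4" "b \<le> 4" using ab(2,3) by auto
    then have "i \<le> 2" "j \<le> 2" using ij(4) by linarith+
    then have "i = 1 \<and> j = 2 \<or> i = 2 \<and> j = 1" using ij(1-3) by presburger
    then show "?r a = ?r b" using ij(4) by auto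
  qed
  have "Q = P" if Q: "primeideal Q (edge_ring ?V)" "binomial_edge_ideal ?V ?E \<subseteq> Q" "Q \<subseteq> P" for Q
  proof (rule antisym[OF Q(3)])
    have edge: "minor i j \<in> Q" if "{i, j} \<in> ?E" for i j
      using Q(2) that binomial_edge_ideal_subset_iff[OF crown_edges_Union primeideal.axioms(1)[OF Q(1)]] by blast
    have zero: "0 \<in> Q"
      using ideal_polysD(2)[OF primeideal_polysD(1)[OF Q(1)[unfolded edge_ring_def]]] .
    have e: "{1, 4} \<in> ?E" "{3, 2} \<in> ?E"
      using edge_in[of 1 2] edge_in[of 2 1] n by simp_all
    show "P \<subseteq> Q"
      unfolding P_def
    proof (rule component_prime_subset[OF finite_crown_vertices U Q(1)])
      show "\<not> (pvar (XVar i) \<in> Q \<and> pvar (YVar i) \<in> Q)" if i: "i \<in> ?U" for i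
      proof -
        have "pvar (XVar i) \<notin> P"
          unfolding P_def var_mem_component_prime(1)[OF subsetD[OF U i]] using i by blast
        then show ?thesis using Q(3) by blast
      qed
      show "minor i j \<in> Q" if "i \<in> ?U" "j \<in> ?U" "?r i = ?r j" for i j
      proof -
        have "i = j \<or> {i, j} = {1, 4} \<or> {i, j} = {3, 2}"
        proof -
          have "i \<in> {1, 4} \<longleftrightarrow> j \<in> {1, 4}"
            using that(3) by (metis zero_neq_one)
          then show ?thesis using that(1,2) by blast
        qed
        then show ?thesis using e edge[of i j] zero by auto
      qed
      show "pvar (XVar v) \<in> Q \<and> pvar (YVar v) \<in> Q" if v: "v \<in> ?V - ?U" for v
      proof (rule ccontr)
        assume alive: "\<not> ?thesis"
        have v5: "v \<ge> 5" "v \<le> 2 * n" using v by (auto simp: crown_vertices_def)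
        obtain a b where ab: "a \<in> ?U" "b \<in> ?U" "?r a \<noteq> ?r b" "{a, v} \<in> ?E" "{v, b} \<in> ?E"
        proof (cases "even v")
          case True
          then obtain k where k: "v = 2 * k" by blast
          then have "3 \<le> k" "k \<le> n" using v5 by linarith+
          then have "{1, v} \<in> ?E" "{3, v} \<in> ?E" using edge_in[of 1 k] edge_in[of 2 k] k by simp_all
          then show ?thesis using that[of 1 3] by (simp add: insert_commute)
        next
          case False
          then obtain k where k: "v = 2 * k + 1" by (auto elim: oddE)
          then have "2 \<le> k" "k + 1 \<le> n" using v5 by linarith+
          then have "{v, 2} \<in> ?E" "{v, 4} \<in> ?E"
            using edge_in[of "k + 1" 1] edge_in[of "k + 1" 2] k by simp_all
          then show ?thesis using that[of 2 4] by (simp add: insert_commute)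
        qed
        have "minor a b \<in> Q"
          by (rule minor_trans[OF Q(1) subsetD[OF U ab(1)] subsetD[OF U ab(2)] DiffD1[OF v]
                alive edge[OF ab(4)] edge[OF ab(5)]])
        then have "minor a b \<in> P" using Q(3) by blast
        then show False
          unfolding P_def minor_mem_component_prime[OF subsetD[OF U ab(1)] subsetD[OF U ab(2)]]
          using ab(1-3) by blast
      qed
    qed
  qed
  moreover have "primeideal P (edge_ring ?V)"
    unfolding P_def by (rule primeideal_component_prime)
  ultimately show "P \<in> minimal_primes (edge_ring ?V) (binomial_edge_ideal ?V ?E)"
    using J by (simp add: minimal_primes_def)
qed

theorem corollary3p5:
  fixes n :: nat
  assumes "n \<ge> 3"
  shows "ideal_height (edge_ring (crown_vertices n))
           (binomial_edge_ideal (crown_vertices n) (crown_edges n) :: (edge_var, 'k::field) mpoly set)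
         = enat (2 * n - 1)
       \<and> big_height (edge_ring (crown_vertices n))
           (binomial_edge_ideal (crown_vertices n) (crown_edges n) :: (edge_var, 'k::field) mpoly set)
         = enat (4 * n - 6)"
proof
  let ?V = "crown_vertices n" and ?E = "crown_edges n"
  let ?J = "binomial_edge_ideal ?V ?E :: (edge_var, 'k) mpoly set"
  show "ideal_height (edge_ring ?V) ?J = enat (2 * n - 1)"
    unfolding ideal_height_def
  proof (rule antisym)
    let ?P = "component_prime ?V ?V (\<lambda>_. 0) :: (edge_var, 'k) mpoly set"
    have "?J \<subseteq> ?P" by (rule binomial_edge_ideal_subset_component_prime[OF crown_edges_Union]) simp
    moreover have "(\<lambda>_. 0 :: nat) ` ?V = {0}"
      using assms by (simp add: crown_vertices_def image_constant_conv)
    then have "prime_height (edge_ring ?V) ?P = enat (2 * n - 1)"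
      using prime_height_component_prime[OF finite_crown_vertices subset_refl, of n "\<lambda>_. 0", where 'k = 'k]
      by (simp add: card_crown_vertices)
    ultimately show "(INF P\<in>{P. primeideal P (edge_ring ?V) \<and> ?J \<subseteq> P}. prime_height (edge_ring ?V) P)
        \<le> enat (2 * n - 1)"
      using primeideal_component_prime[of ?V ?V "\<lambda>_. 0", where 'a = 'k]
      by (intro INF_lower2[of ?P]) auto
  next
    show "enat (2 * n - 1) \<le> (INF P\<in>{P. primeideal P (edge_ring ?V) \<and> ?J \<subseteq> P}. prime_height (edge_ring ?V) P)"
    proof (rule INF_greatest)
      fix P :: "(edge_var, 'k) mpoly set"
      assume "P \<in> {P. primeideal P (edge_ring ?V) \<and> ?J \<subseteq> P}"
      then have P: "primeideal P (edge_ring ?V)" "?J \<subseteq> P" by auto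
      define U where "U = live_vertices ?V P"
      define r where "r = component ?E U"
      have U: "U \<subseteq> ?V" by (auto simp: U_def live_vertices_def)
      have "component_prime ?V U r \<subseteq> P"
        unfolding U_def r_def
        by (rule component_prime_subset_prime[OF finite_crown_vertices crown_edges_Union P])
      then have "prime_chain (edge_ring ?V) (2 * card ?V - card U - card (r ` U)) P"
        using prime_chain_component_prime[OF finite_crown_vertices U] P(1) by (blast intro: prime_chain_mono)
      then have "enat (2 * card ?V - card U - card (r ` U)) \<le> prime_height (edge_ring ?V) P"
        by (rule prime_height_ge)
      moreover have "card (r ` U) \<le> Suc (card (?V - U))"
        unfolding r_def
        using crown_hamiltonian_path[OF assms] by (rule card_components_le_of_path[OF finite_crown_vertices U])
      then have "2 * n - 1 \<le> 2 * card ?V - card U - card (r ` U)"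
        using U card_mono[OF finite_crown_vertices U]
        by (simp add: card_Diff_subset finite_subset[OF U finite_crown_vertices] card_crown_vertices)
      ultimately show "enat (2 * n - 1) \<le> prime_height (edge_ring ?V) P"
        by (meson enat_ord_simps(1) order_trans)
    qed
  qed
  show "big_height (edge_ring ?V) ?J = enat (4 * n - 6)"
    unfolding big_height_def
  proof (rule antisym)
    show "(SUP P\<in>minimal_primes (edge_ring ?V) ?J. prime_height (edge_ring ?V) P) \<le> enat (4 * n - 6)"
      by (rule SUP_least) (rule crown_minimal_prime_height[OF assms])
    show "enat (4 * n - 6) \<le> (SUP P\<in>minimal_primes (edge_ring ?V) ?J. prime_height (edge_ring ?V) P)"
      using crown_extremal_minimal_prime[OF assms, where 'k = 'k] by (metis SUP_upper)
  qed
qed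

end
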